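(* Let $p=\mathbb{P}(\omega=0)$ and fix any positive integer $L$. Then $$\lim_{k\to\infty}\frac{\lambda_1}{\min\frac1u}=\frac{\pi^2}{8}\quad\text{with probability }1-(1-p)^L,$$ and $$\lim_{k\to\infty}\frac{\lambda_1}{\min\frac1u}=1\quad\text{with probability }(1-p)^L.$$ In particular, if $\mathbb{P}(\omega=0)=0$, then $\lim_{k\to\infty}\lambda_1/\min\frac1u=1$ with probability one.
   Context: Let $\{\omega_j\}_{j\in\mathbb{Z}}$ be nonnegative i.i.d. real random variables on a probability space, with $\omega$ denoting a random variable with their common distribution. Let $\chi$ be the characteristic function of $[0,1)$ and $V_\omega(x)=\sum_{j\in\mathbb{Z}}\omega_j\chi(x-j)$, $x\in\mathbb{R}$. For a positive integer $L$ and $k\ge 0$ let $H=-\Delta+kV_\omega$ on $\Omega=(0,L)$ with Dirichlet boundary conditions, where $\Delta=d^2/dx^2$. $\lambda_1$ denotes the smallest (ground state) eigenvalue of $H$ on $\Omega$. $u$ (the landscape function) denotes the unique solution of $Hu=1$ on $\Omega$ with $u(0)=u(L)=0$; it is strictly positive on $(0,L)$. $\min\frac1u$ is the minimum of $1/u$ over $\Omega$, i.e. $1/\max_{[0,L]}u$. Both $\lambda_1$ and $u$ depend on $L,k$ and $\omega$. *)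

theory Defs
  imports "HOL-Probability.Probability"
begin

definition potential :: "(int \<Rightarrow> real) \<Rightarrow> real \<Rightarrow> real" where
  "potential v x = (\<Sum>\<^sub>\<infinity>j. v j * indicator {0..<1} (x - of_int j))"

(* f belongs to the Sobolev space H^2(0,L), represented by its C^1 version on [0,L],
   and g is a representative of its second derivative f'' in L^2(0,L):
   f' is absolutely continuous with derivative g almost everywhere. *)
definition has_second_deriv :: "real \<Rightarrow> (real \<Rightarrow> real) \<Rightarrow> (real \<Rightarrow> real) \<Rightarrow> bool" where
  "has_second_deriv L f g \<longleftrightarrow>
     set_borel_measurable lebesgue {0..L} g \<and>
     set_integrable lebesgue {0..L} (\<lambda>x. (g x)\<^sup>2) \<and>
     (\<exists>f'. \<forall>x\<in>{0..L}. (f has_real_derivative f' x) (at x within {0..L}) \<and>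
                     f' x = f' 0 + (LINT t:{0..x}|lebesgue. g t))"

(* f lies in the Dirichlet domain H^2(0,L) \<inter> H^1_0(0,L), and (-\<Delta> + W) f = h as elements of
   L^2(0,L). *)
definition schroedinger_dirichlet ::
  "real \<Rightarrow> (real \<Rightarrow> real) \<Rightarrow> (real \<Rightarrow> real) \<Rightarrow> (real \<Rightarrow> real) \<Rightarrow> bool" where
  "schroedinger_dirichlet L W f h \<longleftrightarrow>
     f 0 = 0 \<and> f L = 0 \<and>
     (\<exists>g. has_second_deriv L f g \<and>
          (AE x in lebesgue. x \<in> {0<..<L} \<longrightarrow> - g x + W x * f x = h x))"

(* Real-valued eigenfunctions suffice, since the operator is self-adjoint with real coefficients. *)
definition dirichlet_eigenvalue :: "real \<Rightarrow> (real \<Rightarrow> real) \<Rightarrow> real \<Rightarrow> bool" where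
  "dirichlet_eigenvalue L W \<mu> \<longleftrightarrow>
     (\<exists>f. (\<exists>x\<in>{0..L}. f x \<noteq> 0) \<and> schroedinger_dirichlet L W f (\<lambda>x. \<mu> * f x))"

definition ground_state_energy :: "real \<Rightarrow> (real \<Rightarrow> real) \<Rightarrow> real" where
  "ground_state_energy L W = (LEAST \<mu>. dirichlet_eigenvalue L W \<mu>)"

(* The extension by zero outside [0,L] makes the solution unique as a function on the whole line. *)
definition landscape :: "real \<Rightarrow> (real \<Rightarrow> real) \<Rightarrow> real \<Rightarrow> real" where
  "landscape L W =
     (THE u. (\<forall>x. x \<notin> {0..L} \<longrightarrow> u x = 0) \<and> schroedinger_dirichlet L W u (\<lambda>_. 1))"

definition min_inverse_landscape :: "real \<Rightarrow> (real \<Rightarrow> real) \<Rightarrow> real" where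
  "min_inverse_landscape L W = (LEAST m. m \<in> (\<lambda>x. 1 / landscape L W x) ` {0<..<L})"

definition landscape_ratio :: "real \<Rightarrow> real \<Rightarrow> (int \<Rightarrow> real) \<Rightarrow> real" where
  "landscape_ratio L k v =
     ground_state_energy L (\<lambda>x. k * potential v x) /
     min_inverse_landscape L (\<lambda>x. k * potential v x)"

end

theory Submission
  imports Defs
begin

text \<open>
  On the cell \<open>[j, j + 1)\<close> the potential has the constant value \<open>k \<omega>\<^sub>j\<close>, so for each sample the
  claim is about an ordinary differential equation with piecewise constant coefficients. As
  \<open>k\<close> grows, a cell with \<open>\<omega>\<^sub>j > 0\<close> turns into a wall, whereas a cell with \<open>\<omega>\<^sub>j = 0\<close>
  stays free. Almost everything is deterministic: the sample enters only through the question
  whether one of the cells \<open>0, \<dots>, L - 1\<close> is free. The ratio is the product of the ground state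
  energy and the maximum of the landscape function.

  If there is a free cell, let \<open>m\<close> be the length of the longest run of free cells. In the limit
  this run becomes the interval \<open>(0, m)\<close> with Dirichlet conditions, whose ground state energy is
  \<open>(\<pi> / m)\<^sup>2\<close> and whose landscape function \<open>x (m - x) / 2\<close> has maximum \<open>m\<^sup>2 / 8\<close>; the
  product is \<open>\<pi>\<^sup>2 / 8\<close> whatever \<open>m\<close> is. If there is no free cell, let \<open>\<kappa>\<close> be the smallest
  value of the potential. Then the energy lies between \<open>\<kappa>\<close> and \<open>\<kappa> + \<pi>\<^sup>2\<close>, the maximum of the
  landscape function between \<open>1 / (\<kappa> + 8)\<close> and \<open>1 / \<kappa>\<close>, and the product tends to \<open>1\<close>.

  Since the limits \<open>\<pi>\<^sup>2 / 8\<close> and \<open>1\<close> are different, the two events of the theorem are exactly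
  ``some cell is free'' and ``no cell is free'', and independence gives the second one the
  probability \<open>(1 - p)\<^sup>L\<close>.

  Four estimates carry the two deterministic limits.
  \<^item> Energy from above: a solution that starts with value \<open>0\<close> at the left end must have a zero
    when the spectral parameter is \<open>\<kappa> + (\<pi> / m)\<^sup>2\<close> and the potential is \<open>\<kappa>\<close> on \<open>m\<close>
    consecutive cells (\<open>constant_run_has_zero\<close>). The smallest parameter for which such a solution
    has a zero is the lowest eigenvalue, and so the zero turns into an upper bound; this argument
    also shows that a lowest eigenvalue exists (\<open>ground_state_exists\<close>).
  \<^item> Energy from below: a Riccati subsolution, which may jump downwards between cells, bounds
    every eigenvalue (\<open>eigenvalue_ge_if_riccati_subsolution\<close>). It is given by the tangent function on the free
    runs and linear on the walls (\<open>eigenvalue_ge_zero_runs\<close>).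
  \<^item> Landscape from below: comparison with a parabola supported on a run
    (\<open>landscape_max_ge_run\<close>).
  \<^item> Landscape from above: comparison with the constant \<open>1 / \<kappa>\<close>, or, if there are free cells,
    the fact that the landscape function becomes small on walls
    (\<open>landscape_small_on_high_cell\<close>) combined with a parabola on the component of the set where
    it is not small (\<open>landscape_le_zero_run\<close>).

  The equation is treated in classical form (\<open>cell_ode\<close>): function and derivative are
  continuous, and the equation holds away from the integers. The translation from the Sobolev
  formulation is \<open>schroedinger_dirichlet_iff\<close>.
\<close>

section \<open>Calculus with finitely many exceptional points\<close>

lemma FTC_except_finite:
  fixes G g :: "real \<Rightarrow> real"
  assumes "finite S" "a \<le> b" "continuous_on {a..b} G"
    and "\<And>x. x \<in> {a<..<b} - S \<Longrightarrow> (G has_real_derivative g x) (at x)"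
  shows "(g has_integral (G b - G a)) {a..b}"
  by (rule fundamental_theorem_of_calculus_interior_strong[OF assms(1,2)])
    (use assms in \<open>auto simp: has_real_derivative_iff_has_vector_derivative\<close>)

text \<open>
  The potential jumps at the integers, so the derivatives of the quantities studied below exist only
  off a finite set. This is the form in which monotonicity is used for them.
\<close>

lemma mono_except_finite:
  fixes G g :: "real \<Rightarrow> real"
  assumes "finite S" "a \<le> b" "continuous_on {a..b} G"
    and "\<And>x. x \<in> {a<..<b} - S \<Longrightarrow> (G has_real_derivative g x) (at x)"
    and "\<And>x. x \<in> {a<..<b} - S \<Longrightarrow> g x \<ge> 0"
  shows "G a \<le> G b"
proof -
  have "((\<lambda>x. if x \<in> {a<..<b} - S then g x else 0) has_integral (G b - G a)) {a..b}"
    by (rule FTC_except_finite[OF assms(1-3)]) (use assms(4) in auto)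
  then have "G b - G a \<ge> 0"
    by (rule has_integral_nonneg) (use assms(5) in auto)
  then show ?thesis by simp
qed

text \<open>
  Both sides have the same integral representation, and the integrand is continuous; hence the
  exceptional points are harmless for a function whose derivative extends continuously.
\<close>

lemma DERIV_within_except_finite:
  fixes f f' :: "real \<Rightarrow> real"
  assumes "finite S" "continuous_on {a..b} f" "continuous_on {a..b} f'"
    and "\<And>x. x \<in> {a<..<b} - S \<Longrightarrow> (f has_real_derivative f' x) (at x)"
    and "x \<in> {a..b}"
  shows "(f has_real_derivative f' x) (at x within {a..b})"
proof -
  have eq: "f a + integral {a..y} f' = f y" if "y \<in> {a..b}" for y
  proof -
    have "(f' has_integral (f y - f a)) {a..y}"
      by (rule FTC_except_finite[OF assms(1)])
        (use that assms in \<open>auto intro: continuous_on_subset\<close>)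
    then show ?thesis by (simp add: integral_unique)
  qed
  have "((\<lambda>y. integral {a..y} f') has_real_derivative f' x) (at x within {a..b})"
    by (rule integral_has_real_derivative) (use assms in auto)
  then have "((\<lambda>y. f a + integral {a..y} f') has_real_derivative f' x) (at x within {a..b})"
    by (auto intro!: derivative_eq_intros)
  then show ?thesis
    by (rule has_field_derivative_transform_within[where d=1]) (use eq assms(5) in auto)
qed

text \<open>
  This is the weak maximum principle for \<open>- w'' + q w \<ge> 0\<close>. If \<open>w\<close> had a negative minimum
  at \<open>x0\<close>, then up to the next point where \<open>w\<close> is nonnegative \<open>w'' \<le> q w \<le> 0\<close>, so \<open>w'\<close>
  would stay nonpositive and \<open>w\<close> could never return to nonnegative values.
\<close>

lemma comparison_principle:
  fixes w w' w'' q :: "real \<Rightarrow> real"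
  assumes "finite S" "continuous_on {a..b} w" "continuous_on {a..b} w'"
    and "\<And>x. x \<in> {a<..<b} - S \<Longrightarrow> (w has_real_derivative w' x) (at x)"
    and "\<And>x. x \<in> {a<..<b} - S \<Longrightarrow> (w' has_real_derivative w'' x) (at x)"
    and "\<And>x. x \<in> {a<..<b} - S \<Longrightarrow> w'' x \<le> q x * w x"
    and "\<And>x. x \<in> {a<..<b} - S \<Longrightarrow> q x \<ge> 0"
    and "w a \<ge> 0" "w b \<ge> 0" "x \<in> {a..b}"
  shows "w x \<ge> 0"
proof (rule ccontr)
  assume neg: "\<not> w x \<ge> 0"
  obtain x0 where x0: "x0 \<in> {a..b}" "\<And>y. y \<in> {a..b} \<Longrightarrow> w x0 \<le> w y"
    using continuous_attains_inf[of "{a..b}" w] assms(2,10) by fastforce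
  have w0: "w x0 < 0" using x0(2)[OF assms(10)] neg by auto
  have x0i: "a < x0" "x0 < b"
    using x0(1) w0 assms(8,9) by (force simp: less_le)+
  have "(w has_real_derivative w' x0) (at x0 within {a..b})"
    by (rule DERIV_within_except_finite[OF assms(1-4)]) (use x0 in auto)
  then have D0: "(w has_real_derivative w' x0) (at x0)"
    using x0i by (simp add: at_within_Icc_at)
  have "w' x0 = 0"
    by (rule DERIV_local_min[OF D0, of "min (x0 - a) (b - x0)"]) (use x0i in \<open>auto intro!: x0(2) simp: abs_less_iff\<close>)
  \<comment> \<open>Compactness provides the first point after \<open>x0\<close> at which \<open>w\<close> is nonnegative.\<close>
  have "compact {y \<in> {x0..b}. 0 \<le> w y}"
  proof -
    have "closed ({x0..b} \<inter> w -` {0..})"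
      by (rule continuous_closed_preimage)
        (use x0 assms(2) in \<open>auto intro: continuous_on_subset\<close>)
    moreover have "{y \<in> {x0..b}. 0 \<le> w y} = {x0..b} \<inter> ({x0..b} \<inter> w -` {0..})" by auto
    ultimately show ?thesis by (metis compact_Icc compact_Int_closed)
  qed
  then obtain z where z: "z \<in> {x0..b}" "w z \<ge> 0" 
    and zmin: "\<And>y. y \<in> {x0..b} \<Longrightarrow> w y \<ge> 0 \<Longrightarrow> z \<le> y"
    using compact_attains_inf[of "{y \<in> {x0..b}. 0 \<le> w y}"] x0i assms(9) by fastforce
  have negw: "w y < 0" if "x0 \<le> y" "y < z" for y
    using zmin[of y] that z by force
  have w'neg: "w' y \<le> 0" if "y \<in> {x0..z}" for y
  proof -
    have "- w' x0 \<le> - w' y"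
    proof (rule mono_except_finite[OF assms(1), where G="\<lambda>x. - w' x" and g="\<lambda>x. - w'' x"])
      show "continuous_on {x0..y} (\<lambda>x. - w' x)"
        using x0i that z by (intro continuous_intros continuous_on_subset[OF assms(3)]) auto
      fix t assume t: "t \<in> {x0<..<y} - S"
      then have ti: "t \<in> {a<..<b} - S" using x0i that z by auto
      show "((\<lambda>x. - w' x) has_real_derivative - w'' t) (at t)"
        using assms(5)[OF ti] by (rule DERIV_minus)
      have "q t * w t \<le> 0" using assms(7)[OF ti] negw[of t] t that by (simp add: mult_nonneg_nonpos)
      then show "0 \<le> - w'' t" using assms(6)[OF ti] by simp
    qed (use that in auto)
    then show ?thesis using \<open>w' x0 = 0\<close> by simp
  qed
  have "- w x0 \<le> - w z"
  proof (rule mono_except_finite[OF assms(1), where G="\<lambda>x. - w x" and g="\<lambda>x. - w' x"])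
    show "continuous_on {x0..z} (\<lambda>x. - w x)"
      using x0i z by (intro continuous_intros continuous_on_subset[OF assms(2)]) auto
    fix t assume t: "t \<in> {x0<..<z} - S"
    then have ti: "t \<in> {a<..<b} - S" using x0i z by auto
    show "((\<lambda>x. - w x) has_real_derivative - w' t) (at t)"
      using assms(4)[OF ti] by (rule DERIV_minus)
    show "0 \<le> - w' t" using w'neg[of t] t by simp
  qed (use z in auto)
  then show False using w0 z by simp
qed

section \<open>The fundamental solutions on one unit cell\<close>

text \<open>
  For \<open>z = q t\<^sup>2\<close> the functions \<open>even_exp 0 z\<close>, \<open>t even_exp 1 z\<close> and \<open>t\<^sup>2 even_exp 2 z\<close> are
  \<open>cosh (\<surd>q t)\<close>, \<open>sinh (\<surd>q t) / \<surd>q\<close> and \<open>(cosh (\<surd>q t) - 1) / q\<close>, with \<open>cos\<close> and \<open>sin\<close> for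
  negative \<open>q\<close>. The power series covers every sign of \<open>q\<close>, and makes the solutions jointly
  continuous in \<open>q\<close> and \<open>t\<close>, also at \<open>q = 0\<close>.
\<close>

definition even_exp :: "nat \<Rightarrow> real \<Rightarrow> real" where
  "even_exp k z = (\<Sum>n. z ^ n / fact (2 * n + k))"

lemma summable_even_exp: "summable (\<lambda>n. (1 / fact (2 * n + k)) * z ^ n :: real)"
proof (rule summable_comparison_test')
  show "summable (\<lambda>n. \<bar>z\<bar> ^ n / fact n :: real)" using summable_exp[of "\<bar>z\<bar>"] by (simp add: divide_inverse mult.commute)
  fix n :: nat assume "n \<ge> 0"
  have "(fact n :: real) \<le> fact (2 * n + k)" by (intro fact_mono) auto
  then show "norm ((1 / fact (2 * n + k)) * z ^ n :: real) \<le> \<bar>z\<bar> ^ n / fact n"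
    by (simp add: abs_mult power_abs divide_left_mono)
qed

lemma even_exp_sums: "(\<lambda>n. (1 / fact (2 * n + k)) * z ^ n) sums even_exp k z"
  using summable_even_exp[of k z] unfolding even_exp_def by (simp add: summable_sums)

text \<open>
  The derivative is multiplied by \<open>z\<close> so that its power series has the same shape as that of the
  function; the recursion below then reduces to an identity between coefficients.
\<close>

lemma even_exp_DERIV:
  "\<exists>D. (even_exp k has_real_derivative D) (at z) \<and> 
    (\<lambda>n. of_nat n * (1 / fact (2 * n + k)) * z ^ n) sums (z * D)"
proof -
  let ?c = "\<lambda>n. 1 / fact (2 * n + k) :: real"
  have eq: "even_exp k = (\<lambda>z. \<Sum>n. ?c n * z ^ n)" unfolding even_exp_def by simp
  have "(even_exp k has_real_derivative (\<Sum>n. diffs ?c n * z ^ n)) (at z)"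
    unfolding eq by (rule termdiffs_strong_converges_everywhere) (rule summable_even_exp)
  moreover have "summable (\<lambda>n. diffs ?c n * z ^ n)"
    by (rule termdiff_converges_all) (rule summable_even_exp)
  then have "(\<lambda>n. of_nat n * ?c n * z ^ (n - Suc 0)) sums (\<Sum>n. diffs ?c n * z ^ n)"
    by (rule diffs_equiv)
  then have "(\<lambda>n. z * (of_nat n * ?c n * z ^ (n - Suc 0))) sums (z * (\<Sum>n. diffs ?c n * z ^ n))"
    by (rule sums_mult)
  moreover have "z * (of_nat n * ?c n * z ^ (n - Suc 0)) = of_nat n * ?c n * z ^ n" for n
    by (cases n) auto
  ultimately show ?thesis by (intro exI conjI) (assumption, simp only:)
qed

lemma continuous_even_exp [continuous_intros]:
  assumes "continuous_on A h" shows "continuous_on A (\<lambda>x. even_exp k (h x))"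
proof -
  have "continuous_on UNIV (even_exp k)"
    using even_exp_DERIV[of k] by (intro continuous_at_imp_continuous_on) (meson DERIV_isCont)
  then show ?thesis using assms continuous_on_compose2 by blast
qed

lemma even_exp_0: "even_exp k 0 = 1 / fact k"
  unfolding even_exp_def using powser_zero[of "\<lambda>n. 1 / fact (2 * n + k) :: real"] by simp

lemma even_exp_shift: "even_exp 0 z = 1 + z * even_exp 2 z"
proof -
  have "(\<lambda>n. (1 / fact (2 * Suc n + 0)) * z ^ Suc n) sums (z * even_exp 2 z)"
    using sums_mult[OF even_exp_sums[of 2 z], of z] by (simp add: mult_ac)
  then have "(\<lambda>n. (1 / fact (2 * n + 0)) * z ^ n) sums (z * even_exp 2 z + 1)"
    by (subst (asm) sums_Suc_iff) (simp add: add.commute)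
  then show ?thesis using even_exp_sums[of 0 z] by (simp add: sums_iff)
qed

text \<open>
  The three fundamental functions are derivatives of one another. For the coefficients this is
  \<open>(2 n + k + 1) / (2 n + k + 1)! = 1 / (2 n + k)!\<close>.
\<close>

lemma even_exp_chain:
  "((\<lambda>t. t ^ Suc k * even_exp (Suc k) (q * t\<^sup>2)) has_real_derivative t ^ k * even_exp k (q * t\<^sup>2)) (at t)"
proof -
  define z where "z = q * t\<^sup>2"
  obtain D where D: "(even_exp (Suc k) has_real_derivative D) (at z)"
    and s: "(\<lambda>n. of_nat n * (1 / fact (2 * n + Suc k)) * z ^ n) sums (z * D)"
    using even_exp_DERIV by blast
  have "(\<lambda>n. of_nat (Suc k) * ((1 / fact (2 * n + Suc k)) * z ^ n) + 2 * (of_nat n * (1 / fact (2 * n + Suc k)) * z ^ n))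
      sums (of_nat (Suc k) * even_exp (Suc k) z + 2 * (z * D))"
    by (intro sums_add sums_mult s even_exp_sums)
  also have "(\<lambda>n. of_nat (Suc k) * ((1 / fact (2 * n + Suc k)) * z ^ n) + 2 * (of_nat n * (1 / fact (2 * n + Suc k)) * z ^ n))
    = (\<lambda>n. (1 / fact (2 * n + k)) * z ^ n)"
  proof
    fix n :: nat
    have "a * ((1 / F) * Z) + 2 * (m * (1 / F) * Z) = ((2 * m + a) / F) * Z" for a m F Z :: real
      by (simp add: add_divide_distrib algebra_simps)
    then have "of_nat (Suc k) * ((1 / fact (2 * n + Suc k)) * z ^ n) + 2 * (of_nat n * (1 / fact (2 * n + Suc k)) * z ^ n)
      = ((2 * real n + real (Suc k)) / fact (2 * n + Suc k)) * z ^ n" .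
    also have "2 * real n + real (Suc k) = real (2 * n + Suc k)" by simp
    also have "real (2 * n + Suc k) / fact (2 * n + Suc k) = 1 / fact (2 * n + k)"
      by (simp add: fact_Suc del: of_nat_Suc)
    finally show "of_nat (Suc k) * ((1 / fact (2 * n + Suc k)) * z ^ n) + 2 * (of_nat n * (1 / fact (2 * n + Suc k)) * z ^ n)
      = (1 / fact (2 * n + k)) * z ^ n" .
  qed
  finally have id: "of_nat (Suc k) * even_exp (Suc k) z + 2 * (z * D) = even_exp k z"
    using even_exp_sums sums_unique2 by blast
  have "((\<lambda>t. even_exp (Suc k) (q * t\<^sup>2)) has_real_derivative D * (q * (2 * t))) (at t)"
    by (rule DERIV_chain2[where f="even_exp (Suc k)"]) (use D in \<open>auto simp: z_def intro!: derivative_eq_intros\<close>)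
  then have "((\<lambda>t. t ^ Suc k * even_exp (Suc k) (q * t\<^sup>2)) has_real_derivative 
      (of_nat (Suc k) * t ^ k) * even_exp (Suc k) z + D * (q * (2 * t)) * t ^ Suc k) (at t)"
    unfolding z_def by (rule DERIV_mult'[THEN DERIV_cong, rotated]) (auto intro!: derivative_eq_intros simp del: power_Suc)
  moreover have "(of_nat (Suc k) * t ^ k) * even_exp (Suc k) z + D * (q * (2 * t)) * t ^ Suc k = t ^ k * even_exp k z"
    unfolding id[symmetric] by (simp add: z_def algebra_simps power2_eq_square)
  ultimately show ?thesis unfolding z_def by simp
qed

text \<open>
  The solution of \<open>f'' = q f - r\<close> with initial value \<open>y\<close> and initial slope \<open>y'\<close>.
\<close>

definition cell_sol :: "real \<Rightarrow> real \<Rightarrow> real \<Rightarrow> real \<Rightarrow> real \<Rightarrow> real" where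
  "cell_sol r q y y' t = y * even_exp 0 (q * t\<^sup>2) + y' * (t * even_exp 1 (q * t\<^sup>2)) - r * (t\<^sup>2 * even_exp 2 (q * t\<^sup>2))"

definition cell_sol' :: "real \<Rightarrow> real \<Rightarrow> real \<Rightarrow> real \<Rightarrow> real \<Rightarrow> real" where
  "cell_sol' r q y y' t = y' * even_exp 0 (q * t\<^sup>2) + (q * y - r) * (t * even_exp 1 (q * t\<^sup>2))"

lemma cell_sol_0: "cell_sol r q y y' 0 = y" "cell_sol' r q y y' 0 = y'"
  by (simp_all add: cell_sol_def cell_sol'_def even_exp_0)

text \<open>
  Written this way, every term except the constant has a derivative given by \<open>even_exp_chain\<close>.
\<close>

lemma cell_sol_alt: "cell_sol r q y y' t = y + y' * (t * even_exp 1 (q * t\<^sup>2)) + (q * y - r) * (t\<^sup>2 * even_exp 2 (q * t\<^sup>2))"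
  by (simp add: cell_sol_def even_exp_shift algebra_simps)

lemma cell_sol_DERIV:
  "(cell_sol r q y y' has_real_derivative cell_sol' r q y y' t) (at t)"
  "(cell_sol' r q y y' has_real_derivative q * cell_sol r q y y' t - r) (at t)"
proof -
  have S: "((\<lambda>t. t * even_exp 1 (q * t\<^sup>2)) has_real_derivative even_exp 0 (q * t\<^sup>2)) (at t)"
    using even_exp_chain[of 0 q t] by simp
  have P: "((\<lambda>t. t\<^sup>2 * even_exp 2 (q * t\<^sup>2)) has_real_derivative t * even_exp 1 (q * t\<^sup>2)) (at t)"
    using even_exp_chain[of 1 q t] by (simp add: numeral_2_eq_2)
  show "(cell_sol r q y y' has_real_derivative cell_sol' r q y y' t) (at t)"
    unfolding cell_sol_alt cell_sol'_def by (rule derivative_eq_intros S P refl | simp)+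
  have *: "cell_sol' r q y y' = (\<lambda>t. y' * (1 + q * (t\<^sup>2 * even_exp 2 (q * t\<^sup>2))) + (q * y - r) * (t * even_exp 1 (q * t\<^sup>2)))"
    by (rule ext) (simp add: cell_sol'_def even_exp_shift)
  have "(cell_sol' r q y y' has_real_derivative y' * (q * (t * even_exp 1 (q * t\<^sup>2))) + (q * y - r) * even_exp 0 (q * t\<^sup>2)) (at t)"
    unfolding * by (rule derivative_eq_intros S P refl | simp)+
  moreover have "y' * (q * (t * even_exp 1 (q * t\<^sup>2))) + (q * y - r) * even_exp 0 (q * t\<^sup>2) = q * cell_sol r q y y' t - r"
    by (simp add: cell_sol_def even_exp_shift algebra_simps)
  ultimately show "(cell_sol' r q y y' has_real_derivative q * cell_sol r q y y' t - r) (at t)" by simp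
qed

section \<open>Second-order equations with cellwise constant coefficients\<close>

text \<open>
  The equation \<open>f'' = q f - r\<close> on \<open>[0, L]\<close> for a coefficient that is constant on unit cells.
  Nothing is required of the second derivative at the integers, and the first-order equation too is
  only demanded off the integers: it then holds everywhere (\<open>cell_ode_deriv_within\<close>), and
  solutions on adjacent intervals can be glued without computing one-sided derivatives.
\<close>

definition cell_ode :: "nat \<Rightarrow> (int \<Rightarrow> real) \<Rightarrow> real \<Rightarrow> (real \<Rightarrow> real) \<Rightarrow> (real \<Rightarrow> real) \<Rightarrow> bool" where
  "cell_ode L q r f f' \<longleftrightarrow> continuous_on {0..real L} f \<and> continuous_on {0..real L} f' \<and>
     (\<forall>x \<in> {0<..<real L} - \<int>. (f has_real_derivative f' x) (at x) \<and>
        (f' has_real_derivative q \<lfloor>x\<rfloor> * f x - r) (at x))"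

lemma finite_Ints_Icc: "finite (\<int> \<inter> {a..b::real})"
proof -
  have "\<int> \<inter> {a..b} \<subseteq> of_int ` {\<lfloor>a\<rfloor>..\<lceil>b\<rceil>}"
  proof
    fix x assume "x \<in> \<int> \<inter> {a..b}"
    then obtain i where "x = of_int i" "a \<le> x" "x \<le> b" by (auto elim: Ints_cases)
    then show "x \<in> of_int ` {\<lfloor>a\<rfloor>..\<lceil>b\<rceil>}"
      by (intro image_eqI[of _ _ i]) (auto, linarith+)
  qed
  then show ?thesis by (rule finite_subset) auto
qed

text \<open>
  The initial value problem is solved for all spectral parameters \<open>l\<close> at once, because the search
  for the ground state minimises over pairs of a parameter and a zero and needs joint continuity.
\<close>

lemma shooting_solution:
  "\<exists>f g. continuous_on (UNIV \<times> {0..real L}) (\<lambda>p. f (fst p) (snd p)) \<and>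
     continuous_on (UNIV \<times> {0..real L}) (\<lambda>p. g (fst p) (snd p)) \<and>
     (\<forall>l. f l 0 = a \<and> g l 0 = b \<and> cell_ode L (\<lambda>j. c j - l) r (f l) (g l))"
proof (induction L)
  case 0
  show ?case
    by (rule exI[of _ "\<lambda>l x. a"], rule exI[of _ "\<lambda>l x. b"]) (auto simp: cell_ode_def)
next
  case (Suc n)
  then obtain f g where
    cf: "continuous_on (UNIV \<times> {0..real n}) (\<lambda>p. f (fst p) (snd p))" and
    cg: "continuous_on (UNIV \<times> {0..real n}) (\<lambda>p. g (fst p) (snd p))" and
    f0: "\<And>l. f l 0 = a" and g0: "\<And>l. g l 0 = b" and
    ode: "\<And>l. cell_ode n (\<lambda>j. c j - l) r (f l) (g l)" by auto
  define q where "q l = c (int n) - l" for l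
  define F where "F l x = (if x \<le> real n then f l x else cell_sol r (q l) (f l (real n)) (g l (real n)) (x - real n))" for l x
  define G where "G l x = (if x \<le> real n then g l x else cell_sol' r (q l) (f l (real n)) (g l (real n)) (x - real n))" for l x
  have cfn: "continuous_on A (\<lambda>p. f (fst p) (real n))" and cgn: "continuous_on A (\<lambda>p. g (fst p) (real n))"
    for A :: "(real \<times> real) set"
    by (rule continuous_on_compose2[OF cf, of A "\<lambda>p. (fst p, real n)", simplified]
        continuous_on_compose2[OF cg, of A "\<lambda>p. (fst p, real n)", simplified];
        auto intro!: continuous_intros)+
  have cq: "continuous_on A (\<lambda>p. q (fst p))" for A :: "(real \<times> real) set"
    unfolding q_def by (intro continuous_intros)
  have CF: "continuous_on (UNIV \<times> {0..real (Suc n)}) (\<lambda>p. F (fst p) (snd p))"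
    unfolding F_def
    by (rule continuous_on_cases_le)
      (auto simp: cell_sol_0 cell_sol_def even_exp_0 intro!: continuous_intros cfn cgn cq continuous_on_subset[OF cf])
  have CG: "continuous_on (UNIV \<times> {0..real (Suc n)}) (\<lambda>p. G (fst p) (snd p))"
    unfolding G_def
    by (rule continuous_on_cases_le)
      (auto simp: cell_sol_0 cell_sol'_def even_exp_0 intro!: continuous_intros cfn cgn cq continuous_on_subset[OF cg])
  have "cell_ode (Suc n) (\<lambda>j. c j - l) r (F l) (G l)" for l
    unfolding cell_ode_def
  proof (intro conjI ballI)
    show "continuous_on {0..real (Suc n)} (F l)"
      by (rule continuous_on_compose2[OF CF, of _ "\<lambda>x. (l, x)", simplified]) (auto intro!: continuous_intros)
    show "continuous_on {0..real (Suc n)} (G l)"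
      by (rule continuous_on_compose2[OF CG, of _ "\<lambda>x. (l, x)", simplified]) (auto intro!: continuous_intros)
  next
    fix x assume x: "x \<in> {0<..<real (Suc n)} - \<int>"
    then have "x \<noteq> real n" by auto
    then consider "x < real n" | "x > real n" by linarith
    then have "(F l has_real_derivative G l x) (at x) \<and> (G l has_real_derivative (c \<lfloor>x\<rfloor> - l) * F l x - r) (at x)"
    proof cases
      case 1
      then have xn: "x \<in> {0<..<real n} - \<int>" using x by auto
      have d: "(f l has_real_derivative g l x) (at x)" "(g l has_real_derivative (c \<lfloor>x\<rfloor> - l) * f l x - r) (at x)"
        using ode[of l] xn by (auto simp: cell_ode_def)
      show ?thesis
        using has_field_derivative_transform_within_open[OF d(1), of "{0<..<real n}" "F l"]
          has_field_derivative_transform_within_open[OF d(2), of "{0<..<real n}" "G l"] xn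
        by (auto simp: F_def G_def)
    next
      case 2
      have fl: "\<lfloor>x\<rfloor> = int n" using 2 x by (intro floor_unique) auto
      have s: "((\<lambda>x. x - real n) has_real_derivative 1) (at x)"
        by (auto intro!: derivative_eq_intros)
      have d: "((\<lambda>x. cell_sol r (q l) (f l (real n)) (g l (real n)) (x - real n)) has_real_derivative
          cell_sol' r (q l) (f l (real n)) (g l (real n)) (x - real n)) (at x)"
        "((\<lambda>x. cell_sol' r (q l) (f l (real n)) (g l (real n)) (x - real n)) has_real_derivative
          q l * cell_sol r (q l) (f l (real n)) (g l (real n)) (x - real n) - r) (at x)"
        by (rule DERIV_chain2[OF cell_sol_DERIV(1) s, simplified] DERIV_chain2[OF cell_sol_DERIV(2) s, simplified])+
      show ?thesis
        using has_field_derivative_transform_within_open[OF d(1), of "{real n<..}" "F l"]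
          has_field_derivative_transform_within_open[OF d(2), of "{real n<..}" "G l"] 2
        by (auto simp: F_def G_def fl q_def)
    qed
    then show "(F l has_real_derivative G l x) (at x)" "(G l has_real_derivative (c \<lfloor>x\<rfloor> - l) * F l x - r) (at x)"
      by auto
  qed
  moreover have "F l 0 = a" "G l 0 = b" for l using f0 g0 by (auto simp: F_def G_def)
  ultimately show ?case using CF CG by (intro exI[of _ F] exI[of _ G]) auto
qed

lemma cell_odeD:
  assumes "cell_ode L q r f f'"
  shows "continuous_on {0..real L} f" "continuous_on {0..real L} f'"
    "\<And>x. x \<in> {0<..<real L} - (\<int> \<inter> {0..real L}) \<Longrightarrow> (f has_real_derivative f' x) (at x)"
    "\<And>x. x \<in> {0<..<real L} - (\<int> \<inter> {0..real L}) \<Longrightarrow> (f' has_real_derivative q \<lfloor>x\<rfloor> * f x - r) (at x)"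
  using assms by (auto simp: cell_ode_def)

lemma cell_ode_deriv_within:
  assumes "cell_ode L q r f f'" "x \<in> {0..real L}"
  shows "(f has_real_derivative f' x) (at x within {0..real L})"
  by (rule DERIV_within_except_finite[OF finite_Ints_Icc[of 0 "real L"]]) 
    (use cell_odeD[OF assms(1)] assms(2) in auto)

lemma cell_ode_cmult_diff:
  assumes "cell_ode L q r f f'" "cell_ode L q s g g'"
  shows "cell_ode L q (r - a * s) (\<lambda>x. f x - a * g x) (\<lambda>x. f' x - a * g' x)"
  using assms unfolding cell_ode_def
  by (auto intro!: continuous_intros derivative_eq_intros simp: algebra_simps)

text \<open>
  Uniqueness for the initial value problem, in both directions from \<open>x0\<close>, by Gronwall's argument:
  \<open>E = f\<^sup>2 + f'\<^sup>2\<close> satisfies \<open>\<bar>E'\<bar> \<le> K E\<close>, so \<open>exp (- K x) E\<close> decreases and \<open>exp (K x) E\<close>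
  increases.
\<close>

lemma cell_ode_zero_data:
  assumes ode: "cell_ode L q 0 f f'" and x0: "x0 \<in> {0..real L}" "f x0 = 0" "f' x0 = 0"
    and x: "x \<in> {0..real L}"
  shows "f x = 0" "f' x = 0"
proof -
  define S where "S = \<int> \<inter> {0..real L}"
  have S: "finite S" unfolding S_def by (rule finite_Ints_Icc)
  define E where "E x = (f x)\<^sup>2 + (f' x)\<^sup>2" for x
  define K where "K = 1 + (\<Sum>j\<in>{0..<int L}. \<bar>q j\<bar>)"
  define e where "e x = 2 * f x * f' x * (1 + q \<lfloor>x\<rfloor>)" for x
  note D = cell_odeD[OF ode, folded S_def]
  have dE: "(E has_real_derivative e x) (at x)" if "x \<in> {0<..<real L} - S" for x
    unfolding E_def e_def
    by (rule derivative_eq_intros D(3,4) that refl)+ (simp add: algebra_simps)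
  have bound: "\<bar>e x\<bar> \<le> K * E x" if "x \<in> {0<..<real L} - S" for x
  proof -
    have "\<lfloor>x\<rfloor> \<in> {0..<int L}" using that by (auto simp: floor_less_iff)
    then have "\<bar>q \<lfloor>x\<rfloor>\<bar> \<le> (\<Sum>j\<in>{0..<int L}. \<bar>q j\<bar>)" by (intro member_le_sum) auto
    then have "\<bar>1 + q \<lfloor>x\<rfloor>\<bar> \<le> K" unfolding K_def by linarith
    moreover have "\<bar>2 * f x * f' x\<bar> \<le> E x"
      unfolding E_def using sum_squares_bound[of "f x" "f' x"] sum_squares_bound[of "- f x" "f' x"] 
      by (simp add: abs_le_iff power2_eq_square)
    ultimately have "\<bar>2 * f x * f' x\<bar> * \<bar>1 + q \<lfloor>x\<rfloor>\<bar> \<le> E x * K" by (intro mult_mono) auto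
    then show ?thesis by (simp add: e_def abs_mult mult.commute)
  qed
  have cE: "continuous_on {0..real L} E" unfolding E_def by (intro continuous_intros D(1,2))
  have "E x \<le> 0"
  proof (cases "x0 \<le> x")
    case True
    have "- (exp (- K * x0) * E x0) \<le> - (exp (- K * x) * E x)"
    proof (rule mono_except_finite[OF S True, where G="\<lambda>x. - (exp (- K * x) * E x)" and g="\<lambda>x. exp (- K * x) * (K * E x - e x)"])
      show "continuous_on {x0..x} (\<lambda>x. - (exp (- K * x) * E x))"
        using x0 x by (intro continuous_intros continuous_on_subset[OF cE]) auto
      fix t assume "t \<in> {x0<..<x} - S"
      then have t: "t \<in> {0<..<real L} - S" using x0 x by auto
      show "((\<lambda>x. - (exp (- K * x) * E x)) has_real_derivative exp (- K * t) * (K * E t - e t)) (at t)"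
        by (rule derivative_eq_intros dE t refl)+ (simp add: algebra_simps)
      show "0 \<le> exp (- K * t) * (K * E t - e t)" using bound[OF t] by (simp add: abs_le_iff)
    qed
    then show ?thesis using x0 by (simp add: E_def mult_le_0_iff)
  next
    case False
    then have "x \<le> x0" by simp
    have "exp (K * x) * E x \<le> exp (K * x0) * E x0"
    proof (rule mono_except_finite[OF S \<open>x \<le> x0\<close>, where G="\<lambda>x. (exp (K * x) * E x)" and g="\<lambda>x. exp (K * x) * (K * E x + e x)"])
      show "continuous_on {x..x0} (\<lambda>x. (exp (K * x) * E x))"
        using x0 x by (intro continuous_intros continuous_on_subset[OF cE]) auto
      fix t assume "t \<in> {x<..<x0} - S"
      then have t: "t \<in> {0<..<real L} - S" using x0 x by auto
      show "((\<lambda>x. (exp (K * x) * E x)) has_real_derivative exp (K * t) * (K * E t + e t)) (at t)"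
        by (rule derivative_eq_intros dE t refl)+ (simp add: algebra_simps)
      show "0 \<le> exp (K * t) * (K * E t + e t)" using bound[OF t] by (simp add: abs_le_iff)
    qed
    then show ?thesis using x0 by (simp add: E_def mult_le_0_iff)
  qed
  then show "f x = 0" "f' x = 0" unfolding E_def by (simp_all add: sum_power2_le_zero_iff)
qed

section \<open>The Dirichlet problem in classical form\<close>

lemma bounded_set_integrable:
  fixes g :: "real \<Rightarrow> real"
  assumes "set_borel_measurable lebesgue {a..b} g" "\<And>x. x \<in> {a..b} \<Longrightarrow> \<bar>g x\<bar> \<le> B"
  shows "set_integrable lebesgue {a..b} g"
  unfolding set_integrable_def
proof (rule integrableI_bounded_set[where A="{a..b}" and B=B])
  show "(\<lambda>x. indicator {a..b} x *\<^sub>R g x) \<in> borel_measurable lebesgue"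
    using assms(1) unfolding set_borel_measurable_def .
qed (use assms(2) in \<open>auto simp: emeasure_lborel_Icc_eq\<close>)

text \<open>
  The second derivative of a classical solution has the form \<open>G\<close>. Measurability and boundedness
  make it and its square integrable, as the Sobolev formulation requires.
\<close>

lemma cell_rhs_properties:
  fixes c :: "int \<Rightarrow> real" and f :: "real \<Rightarrow> real" and \<mu> r :: real
  assumes cf: "continuous_on {0..real L} f"
  defines "G \<equiv> (\<lambda>x. (c \<lfloor>x\<rfloor> - \<mu>) * f x - r)"
  shows "set_borel_measurable lebesgue {0..real L} G" "\<exists>B. \<forall>x\<in>{0..real L}. \<bar>G x\<bar> \<le> B"
proof -
  have "(\<lambda>x. indicator {0..real L} x *\<^sub>R f x) \<in> borel_measurable borel"
    by (rule borel_measurable_continuous_on_indicator) (use cf in auto)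
  moreover have "(\<lambda>x::real. c \<lfloor>x\<rfloor> - \<mu>) \<in> borel_measurable borel"
    by (rule borel_measurable_diff measurable_compose[OF measurable_real_floor] measurable_const | simp)+
  ultimately have "(\<lambda>x. (c \<lfloor>x\<rfloor> - \<mu>) * (indicator {0..real L} x *\<^sub>R f x) - r * indicator {0..real L} x) \<in> borel_measurable borel"
    by measurable
  also have "(\<lambda>x. (c \<lfloor>x\<rfloor> - \<mu>) * (indicator {0..real L} x *\<^sub>R f x) - r * indicator {0..real L} x) = 
     (\<lambda>x. indicator {0..real L} x *\<^sub>R G x)"
    by (auto simp: G_def indicator_def)
  finally show "set_borel_measurable lebesgue {0..real L} G"
    unfolding set_borel_measurable_def by (intro measurable_completion) simp
  have "bounded (f ` {0..real L})"
    by (rule compact_imp_bounded[OF compact_continuous_image[OF cf compact_Icc]])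
  then obtain F where "\<forall>y \<in> f ` {0..real L}. norm y \<le> F" unfolding bounded_iff by blast
  then have F: "\<bar>f x\<bar> \<le> F" if "x \<in> {0..real L}" for x using that by auto
  define K where "K = (\<Sum>j\<in>{0..int L}. \<bar>c j - \<mu>\<bar>)"
  have "\<bar>G x\<bar> \<le> K * F + \<bar>r\<bar>" if x: "x \<in> {0..real L}" for x
  proof -
    have "\<lfloor>x\<rfloor> \<in> {0..int L}" using x by (auto simp: floor_le_iff)
    then have "\<bar>c \<lfloor>x\<rfloor> - \<mu>\<bar> \<le> K" unfolding K_def by (intro member_le_sum) auto
    then have "\<bar>c \<lfloor>x\<rfloor> - \<mu>\<bar> * \<bar>f x\<bar> \<le> K * F" using F[OF x] by (intro mult_mono) (auto simp: K_def sum_nonneg)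
    then show ?thesis unfolding G_def using abs_triangle_ineq4[of "(c \<lfloor>x\<rfloor> - \<mu>) * f x" r] by (simp add: abs_mult)
  qed
  then show "\<exists>B. \<forall>x\<in>{0..real L}. \<bar>G x\<bar> \<le> B" by blast
qed

text \<open>
  The right-hand side \<open>\<mu> f + r\<close> covers the eigenvalue equation (\<open>r = 0\<close>) and the landscape
  equation (\<open>\<mu> = 0\<close>, \<open>r = 1\<close>). A weak second derivative agrees almost everywhere with
  \<open>(c - \<mu>) f - r\<close>, which is continuous off the integers since \<open>f\<close> is continuous, so its
  indefinite integral is classically differentiable there.
\<close>

lemma schroedinger_dirichlet_iff:
  "schroedinger_dirichlet (real L) (\<lambda>x. c \<lfloor>x\<rfloor>) f (\<lambda>x. \<mu> * f x + r) \<longleftrightarrow>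
     f 0 = 0 \<and> f (real L) = 0 \<and> (\<exists>f'. cell_ode L (\<lambda>j. c j - \<mu>) r f f')"
proof -
  define G where "G = (\<lambda>x. (c \<lfloor>x\<rfloor> - \<mu>) * f x - r)"
  define S where "S = \<int> \<inter> {0..real L}"
  have S: "finite S" unfolding S_def by (rule finite_Ints_Icc)
  have G_integral: "set_integrable lebesgue {0..real L} G" "G integrable_on {0..x}"
      "(LINT t:{0..x}|lebesgue. G t) = integral {0..x} G" "set_borel_measurable lebesgue {0..x} G"
    if "continuous_on {0..real L} f" "x \<in> {0..real L}" for x
  proof -
    have P: "set_borel_measurable lebesgue {0..real L} G" "\<exists>B. \<forall>x\<in>{0..real L}. \<bar>G x\<bar> \<le> B"
      using cell_rhs_properties[OF that(1), of c \<mu> r] unfolding G_def by auto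
    show 1: "set_integrable lebesgue {0..real L} G" using P bounded_set_integrable by blast
    then have "set_integrable lebesgue {0..x} G"
      by (rule set_integrable_subset) (use that in auto)
    then show "G integrable_on {0..x}" "(LINT t:{0..x}|lebesgue. G t) = integral {0..x} G"
      using set_lebesgue_integral_eq_integral by auto
    show "set_borel_measurable lebesgue {0..x} G" 
      by (rule set_borel_measurable_subset[OF P(1)]) (use that in auto)
  qed
  have fwd: "\<exists>f'. cell_ode L (\<lambda>j. c j - \<mu>) r f f'" 
    if has: "has_second_deriv (real L) f g" and ae: "AE x in lebesgue. x \<in> {0<..<real L} \<longrightarrow> - g x + c \<lfloor>x\<rfloor> * f x = \<mu> * f x + r" for g
  proof -
    obtain f' where f': "\<And>x. x \<in> {0..real L} \<Longrightarrow> (f has_real_derivative f' x) (at x within {0..real L})"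
      "\<And>x. x \<in> {0..real L} \<Longrightarrow> f' x = f' 0 + (LINT t:{0..x}|lebesgue. g t)"
      and gm: "set_borel_measurable lebesgue {0..real L} g"
      using has unfolding has_second_deriv_def by blast
    have cf: "continuous_on {0..real L} f" using f'(1) by (rule DERIV_continuous_on)
    have ne: "AE x in lebesgue. x \<noteq> a" for a :: real
      by (rule AE_completion) (rule AE_lborel_singleton)
    have eq: "f' x = f' 0 + integral {0..x} G" if x: "x \<in> {0..real L}" for x
    proof -
      have "set_borel_measurable lebesgue {0..x} g"
        by (rule set_borel_measurable_subset[OF gm]) (use x in auto)
      moreover have "AE t in lebesgue. indicator {0..x} t *\<^sub>R g t = indicator {0..x} t *\<^sub>R G t"
        using ae ne[of 0] ne[of "real L"]
      proof eventually_elim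
        case (elim t)
        have "g t = G t" if "t \<in> {0..x}"
        proof -
          have "t \<in> {0<..<real L}" using that elim x by auto
          then have "- g t + c \<lfloor>t\<rfloor> * f t = \<mu> * f t + r" using elim by blast
          then show ?thesis unfolding G_def left_diff_distrib by linarith
        qed
        then show ?case by (simp add: indicator_def)
      qed
      ultimately have "(LINT t:{0..x}|lebesgue. g t) = (LINT t:{0..x}|lebesgue. G t)"
        using G_integral(4)[OF cf x] unfolding set_lebesgue_integral_def set_borel_measurable_def
        by (intro integral_cong_AE)
      then show ?thesis using f'(2)[OF x] G_integral(3)[OF cf x] by (simp only:)
    qed
    have Gi: "G integrable_on {0..real L}" using G_integral(2)[OF cf, of "real L"] by simp
    have "cell_ode L (\<lambda>j. c j - \<mu>) r f f'"
      unfolding cell_ode_def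
    proof (intro conjI ballI)
      show "continuous_on {0..real L} f" by (rule cf)
      have "continuous_on {0..real L} (\<lambda>x. f' 0 + integral {0..x} G)"
        by (rule continuous_on_add[OF continuous_on_const indefinite_integral_continuous_1[OF Gi]])
      then show "continuous_on {0..real L} f'" 
        by (rule continuous_on_eq) (rule eq[symmetric])
      fix x assume x: "x \<in> {0<..<real L} - \<int>"
      show "(f has_real_derivative f' x) (at x)"
        using f'(1)[of x] x by (simp add: at_within_Icc_at)
      have "isCont G x"
      proof -
        have "isCont f x" using cf x by (simp add: continuous_on_interior)
        moreover have "isCont (\<lambda>x. c \<lfloor>x\<rfloor>) x"
        proof -
          have "x \<in> {of_int \<lfloor>x\<rfloor> <..< of_int \<lfloor>x\<rfloor> + 1}"
          proof -
            have "x \<noteq> of_int \<lfloor>x\<rfloor>" using x by (metis DiffD2 Ints_of_int)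
            then show ?thesis unfolding greaterThanLessThan_iff by linarith
          qed
          then have "eventually (\<lambda>y. y \<in> {of_int \<lfloor>x\<rfloor> <..< of_int \<lfloor>x\<rfloor> + 1}) (nhds x)"
            by (intro eventually_nhds_in_open) auto
          then have "eventually (\<lambda>y. c \<lfloor>y\<rfloor> = c \<lfloor>x\<rfloor>) (nhds x)"
          proof eventually_elim
            case (elim y)
            then have "\<lfloor>y\<rfloor> = \<lfloor>x\<rfloor>" by (intro floor_unique) auto
            then show ?case by simp
          qed
          then show ?thesis using isCont_cong[of "\<lambda>y. c \<lfloor>y\<rfloor>" "\<lambda>_. c \<lfloor>x\<rfloor>" x] by simp
        qed
        ultimately show ?thesis unfolding G_def by (intro continuous_intros)
      qed
      then have "((\<lambda>x. integral {0..x} G) has_vector_derivative G x) (at x within {0..real L} - {})"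
        using x
        by (intro integral_has_vector_derivative_continuous_at[OF Gi])
          (auto simp: continuous_at_imp_continuous_at_within)
      then have "((\<lambda>x. integral {0..x} G) has_real_derivative G x) (at x)"
        using x by (simp add: has_real_derivative_iff_has_vector_derivative at_within_Icc_at)
      then have "((\<lambda>x. f' 0 + integral {0..x} G) has_real_derivative G x) (at x)"
        by (auto intro!: derivative_eq_intros)
      then have "(f' has_real_derivative G x) (at x)"
        by (rule has_field_derivative_transform_within_open[where S="{0<..<real L}"])
          (use x in \<open>auto intro!: eq[symmetric]\<close>)
      then show "(f' has_real_derivative (c \<lfloor>x\<rfloor> - \<mu>) * f x - r) (at x)" by (simp add: G_def)
    qed
    then show ?thesis by blast
  qed
  have bwd: "has_second_deriv (real L) f G" if ode: "cell_ode L (\<lambda>j. c j - \<mu>) r f f'" for f'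
  proof -
    note D = cell_odeD[OF ode, folded S_def]
    have P: "set_borel_measurable lebesgue {0..real L} G" "\<exists>B. \<forall>x\<in>{0..real L}. \<bar>G x\<bar> \<le> B"
      using cell_rhs_properties[OF D(1), of c \<mu> r] unfolding G_def by auto
    have "set_borel_measurable lebesgue {0..real L} (\<lambda>x. (G x)\<^sup>2)"
    proof -
      have "(\<lambda>x. (indicator {0..real L} x *\<^sub>R G x)\<^sup>2) \<in> borel_measurable lebesgue"
        using P(1) unfolding set_borel_measurable_def by measurable
      moreover have "(\<lambda>x. (indicator {0..real L} x *\<^sub>R G x)\<^sup>2) = (\<lambda>x. indicator {0..real L} x *\<^sub>R (G x)\<^sup>2)"
        by (auto simp: indicator_def)
      ultimately show ?thesis unfolding set_borel_measurable_def by simp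
    qed
    moreover obtain B where "\<And>x. x \<in> {0..real L} \<Longrightarrow> \<bar>G x\<bar> \<le> B" using P(2) by blast
    then have "\<bar>(G x)\<^sup>2\<bar> \<le> B\<^sup>2" if "x \<in> {0..real L}" for x
      using power_mono[of "\<bar>G x\<bar>" B 2] that by simp
    ultimately have sq: "set_integrable lebesgue {0..real L} (\<lambda>x. (G x)\<^sup>2)" 
      by (rule bounded_set_integrable)
    have "f' x = f' 0 + (LINT t:{0..x}|lebesgue. G t)" if x: "x \<in> {0..real L}" for x
    proof -
      have "(G has_integral (f' x - f' 0)) {0..x}"
        unfolding G_def
        by (rule FTC_except_finite[OF S]) (use x D(4) in \<open>auto intro: continuous_on_subset[OF D(2)]\<close>)
      then show ?thesis using G_integral(3)[OF D(1) x] by (simp add: integral_unique)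
    qed
    then show ?thesis
      unfolding has_second_deriv_def using P(1) sq cell_ode_deriv_within[OF ode] by blast
  qed
  show ?thesis
  proof
    assume "schroedinger_dirichlet (real L) (\<lambda>x. c \<lfloor>x\<rfloor>) f (\<lambda>x. \<mu> * f x + r)"
    then show "f 0 = 0 \<and> f (real L) = 0 \<and> (\<exists>f'. cell_ode L (\<lambda>j. c j - \<mu>) r f f')"
      unfolding schroedinger_dirichlet_def using fwd by blast
  next
    assume "f 0 = 0 \<and> f (real L) = 0 \<and> (\<exists>f'. cell_ode L (\<lambda>j. c j - \<mu>) r f f')"
    moreover have "AE x in lebesgue. x \<in> {0<..<real L} \<longrightarrow> - G x + c \<lfloor>x\<rfloor> * f x = \<mu> * f x + r"
      by (simp add: G_def algebra_simps)
    ultimately show "schroedinger_dirichlet (real L) (\<lambda>x. c \<lfloor>x\<rfloor>) f (\<lambda>x. \<mu> * f x + r)"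
      unfolding schroedinger_dirichlet_def using bwd by blast
  qed
qed

section \<open>Existence of the ground state by shooting\<close>

lemma cell_ode_vanishing:
  assumes ode: "cell_ode L q 0 f f'" and ab: "0 \<le> a" "a < b" "b \<le> real L"
    and z: "\<And>x. x \<in> {a<..<b} \<Longrightarrow> f x = 0"
  shows "f' 0 = 0"
proof -
  define m where "m = (a + b) / 2"
  have m: "m \<in> {a<..<b}" using ab by (simp add: m_def)
  have "(f has_real_derivative f' m) (at m)"
    using cell_ode_deriv_within[OF ode, of m] m ab by (simp add: at_within_Icc_at)
  then have "((\<lambda>_. 0) has_real_derivative f' m) (at m)"
    by (rule has_field_derivative_transform_within_open[where S="{a<..<b}"]) (use m z in auto)
  then have "f' m = 0" using DERIV_const DERIV_unique by blast
  then show ?thesis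
    using cell_ode_zero_data(2)[OF ode, of m 0] z[OF m] m ab by auto
qed

text \<open>
  When \<open>q \<ge> 0\<close>, the product \<open>f f'\<close> has derivative \<open>f'\<^sup>2 + q f\<^sup>2 \<ge> 0\<close>, so it is
  nonnegative and \<open>f\<^sup>2\<close> increases; a second zero forces \<open>f\<close> to vanish in between. This shows that
  all eigenvalues are positive and that the landscape equation is uniquely solvable.
\<close>

lemma nonneg_potential_no_second_zero:
  assumes ode: "cell_ode L q 0 f f'" and q: "\<And>j. j \<in> {0..<int L} \<Longrightarrow> q j \<ge> 0"
    and "f 0 = 0" and x0: "x0 \<in> {0<..real L}" "f x0 = 0"
  shows "f' 0 = 0"
proof (rule cell_ode_vanishing[OF ode, of 0 x0])
  define S where "S = \<int> \<inter> {0..real L}"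
  have S: "finite S" unfolding S_def by (rule finite_Ints_Icc)
  note D = cell_odeD[OF ode, folded S_def]
  have H: "0 \<le> f x * f' x" if x: "x \<in> {0..real L}" for x
  proof -
    have "f 0 * f' 0 \<le> f x * f' x"
    proof (rule mono_except_finite[OF S, where G="\<lambda>x. f x * f' x" and g="\<lambda>x. (f' x)\<^sup>2 + q \<lfloor>x\<rfloor> * (f x)\<^sup>2"])
      show "continuous_on {0..x} (\<lambda>x. f x * f' x)"
        using x by (intro continuous_intros continuous_on_subset[OF D(1)] continuous_on_subset[OF D(2)]) auto
      fix t assume "t \<in> {0<..<x} - S"
      then have t: "t \<in> {0<..<real L} - S" using x by auto
      show "((\<lambda>x. f x * f' x) has_real_derivative (f' t)\<^sup>2 + q \<lfloor>t\<rfloor> * (f t)\<^sup>2) (at t)"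
        by (rule derivative_eq_intros D(3,4) t refl)+ (simp add: power2_eq_square)
      have "\<lfloor>t\<rfloor> \<in> {0..<int L}" using t by (auto simp: floor_less_iff)
      then show "0 \<le> (f' t)\<^sup>2 + q \<lfloor>t\<rfloor> * (f t)\<^sup>2" using q by simp
    qed (use x in auto)
    then show ?thesis using \<open>f 0 = 0\<close> by simp
  qed
  fix x assume x: "x \<in> {0<..<x0}"
  have "(f x)\<^sup>2 \<le> (f x0)\<^sup>2"
  proof (rule mono_except_finite[OF S, where G="\<lambda>x. (f x)\<^sup>2" and g="\<lambda>x. 2 * (f x * f' x)"])
    show "continuous_on {x..x0} (\<lambda>x. (f x)\<^sup>2)"
      using x x0 by (intro continuous_intros continuous_on_subset[OF D(1)]) auto
    fix t assume "t \<in> {x<..<x0} - S"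
    then have t: "t \<in> {0<..<real L} - S" using x x0 by auto
    show "((\<lambda>x. (f x)\<^sup>2) has_real_derivative 2 * (f t * f' t)) (at t)"
      by (rule derivative_eq_intros D(3) t refl)+ simp
    show "0 \<le> 2 * (f t * f' t)" using H[of t] t by auto
  qed (use x in auto)
  then show "f x = 0" using x0 by simp
qed (use x0 in auto)

lemma dirichlet_eigenvalue_iff:
  "dirichlet_eigenvalue (real L) (\<lambda>x. c \<lfloor>x\<rfloor>) \<mu> \<longleftrightarrow>
     (\<exists>f f'. cell_ode L (\<lambda>j. c j - \<mu>) 0 f f' \<and> f 0 = 0 \<and> f (real L) = 0 \<and> (\<exists>x\<in>{0..real L}. f x \<noteq> 0))"
  using schroedinger_dirichlet_iff[of L c _ \<mu> 0] unfolding dirichlet_eigenvalue_def by auto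

text \<open>
  On the run \<open>f\<close> is a combination of \<open>sin\<close> and \<open>cos\<close> with frequency \<open>\<pi> / m\<close>, so it changes
  its sign over half a period. The Wronskian with a single sine wave that vanishes at both ends of
  the run expresses this without solving for the coefficients.
\<close>

lemma constant_run_antiperiodic:
  assumes ode: "cell_ode L q 0 f f'" and m: "m > 0" "a + m \<le> L"
    and q: "\<And>j. j \<in> {int a..<int (a + m)} \<Longrightarrow> q j = - (pi / real m)\<^sup>2"
  shows "f (real (a + m)) = - f (real a)"
proof -
  define S where "S = \<int> \<inter> {0..real L}"
  have S: "finite S" unfolding S_def by (rule finite_Ints_Icc)
  note D = cell_odeD[OF ode, folded S_def]
  define \<alpha> where "\<alpha> = pi / real m"
  define w where "w x = f' x * sin (\<alpha> * (x - real a)) - f x * (\<alpha> * cos (\<alpha> * (x - real a)))" for x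
  have "((\<lambda>_. 0) has_integral (w (real (a + m)) - w (real a))) {real a..real (a + m)}"
  proof (rule FTC_except_finite[OF S])
    show "continuous_on {real a..real (a + m)} w"
      unfolding w_def using m
      by (intro continuous_intros continuous_on_subset[OF D(1)] continuous_on_subset[OF D(2)]) auto
    fix t assume t0: "t \<in> {real a<..<real (a + m)} - S"
    have t: "t \<in> {0<..<real L} - S" using t0 m by auto
    have "\<lfloor>t\<rfloor> \<in> {int a..<int (a + m)}" using t0 by (auto simp: floor_less_iff le_floor_iff)
    then have "q \<lfloor>t\<rfloor> = - \<alpha>\<^sup>2" using q by (simp add: \<alpha>_def)
    then show "(w has_real_derivative 0) (at t)"
      unfolding w_def
      by - (rule derivative_eq_intros D(3,4) t refl | simp add: power2_eq_square)+
  qed simp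
  then have "w (real (a + m)) = w (real a)" using has_integral_unique has_integral_0 by fastforce
  moreover have "\<alpha> * real m = pi" using m by (auto simp: \<alpha>_def)
  moreover have "\<alpha> > 0" using m by (auto simp: \<alpha>_def)
  ultimately have "(f (real (a + m)) + f (real a)) * \<alpha> = 0" by (simp add: w_def algebra_simps)
  then show ?thesis using \<open>\<alpha> > 0\<close> by (simp add: add_eq_0_iff)
qed

lemma constant_run_has_zero:
  assumes ode: "cell_ode L q 0 f f'" and m: "m > 0" "a + m \<le> L"
    and q: "\<And>j. j \<in> {int a..<int (a + m)} \<Longrightarrow> q j = - (pi / real m)\<^sup>2"
  shows "\<exists>x\<in>{0<..real L}. f x = 0"
proof -
  note anti = constant_run_antiperiodic[OF assms]
  have cf: "continuous_on {real a..real (a + m)} f"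
    using cell_odeD(1)[OF ode] by (rule continuous_on_subset) (use m in auto)
  obtain x where x: "x \<in> {real a..real (a + m)}" "f x = 0"
  proof (cases "f (real a) \<le> 0")
    case True
    then show ?thesis using IVT'[of f "real a" 0 "real (a + m)"] cf anti that by auto
  next
    case False
    then show ?thesis using IVT2'[of f "real (a + m)" 0 "real a"] cf anti that by auto
  qed
  show ?thesis
  proof (cases "x = real a")
    case True
    then show ?thesis using x anti m by (intro bexI[of _ "real (a + m)"]) auto
  next
    case False
    then show ?thesis using x m by (intro bexI[of _ x]) auto
  qed
qed

text \<open>
  Let \<open>f l\<close> be the solution for the parameter \<open>l\<close> that starts at \<open>0\<close> with slope \<open>1\<close>; the
  eigenvalues are the \<open>l\<close> with \<open>f l L = 0\<close>. Consider the smallest \<open>l\<close> for which \<open>f l\<close> has a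
  zero anywhere in \<open>(0, L]\<close>. That zero must be at \<open>L\<close>: at a zero inside the interval \<open>f l\<close>
  would change its sign, and by continuity so would \<open>f l'\<close> for some smaller \<open>l'\<close>. Hence \<open>l\<close>
  is an eigenvalue, and by its choice the lowest one. Any parameter for which \<open>f\<close> has a zero
  is an upper bound for it, in particular the one from \<open>constant_run_has_zero\<close>.
\<close>

lemma ground_state_exists:
  fixes c :: "int \<Rightarrow> real" and L a m :: nat and \<kappa> :: real
  assumes c: "\<And>j. j \<in> {0..<int L} \<Longrightarrow> c j \<ge> 0" and m: "m > 0" "a + m \<le> L"
    and run: "\<And>j. j \<in> {int a..<int (a + m)} \<Longrightarrow> c j = \<kappa>"
  shows "\<exists>E. dirichlet_eigenvalue (real L) (\<lambda>x. c \<lfloor>x\<rfloor>) E \<and>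
     (\<forall>\<mu>. dirichlet_eigenvalue (real L) (\<lambda>x. c \<lfloor>x\<rfloor>) \<mu> \<longrightarrow> E \<le> \<mu>) \<and> E \<le> \<kappa> + (pi / real m)\<^sup>2"
proof -
  obtain f g where
    cf: "continuous_on (UNIV \<times> {0..real L}) (\<lambda>p. f (fst p) (snd p))" and
    cg: "continuous_on (UNIV \<times> {0..real L}) (\<lambda>p. g (fst p) (snd p))" and
    f0: "\<And>l. f l 0 = 0" and g0: "\<And>l. g l 0 = 1" and
    ode: "\<And>l. cell_ode L (\<lambda>j. c j - l) 0 (f l) (g l)"
    using shooting_solution[of L 0 1 c 0] by blast
  have Lpos: "L > 0" using m by simp
  have eigen: "dirichlet_eigenvalue (real L) (\<lambda>x. c \<lfloor>x\<rfloor>) \<mu> \<longleftrightarrow> f \<mu> (real L) = 0" for \<mu>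
  proof
    assume "dirichlet_eigenvalue (real L) (\<lambda>x. c \<lfloor>x\<rfloor>) \<mu>"
    then obtain h h' where h: "cell_ode L (\<lambda>j. c j - \<mu>) 0 h h'" "h 0 = 0" "h (real L) = 0" "\<exists>x\<in>{0..real L}. h x \<noteq> 0"
      unfolding dirichlet_eigenvalue_iff by blast
    have d: "cell_ode L (\<lambda>j. c j - \<mu>) 0 (\<lambda>x. h x - h' 0 * f \<mu> x) (\<lambda>x. h' x - h' 0 * g \<mu> x)"
      using cell_ode_cmult_diff[OF h(1) ode[of \<mu>], of "h' 0"] by simp
    have "h x - h' 0 * f \<mu> x = 0" if "x \<in> {0..real L}" for x
      by (rule cell_ode_zero_data(1)[OF d, of 0]) (use h f0 g0 that in auto)
    then have eq: "h x = h' 0 * f \<mu> x" if "x \<in> {0..real L}" for x using that by auto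
    then have "h' 0 \<noteq> 0" using h(4) by auto
    then show "f \<mu> (real L) = 0" using eq[of "real L"] h(3) by simp
  next
    assume z: "f \<mu> (real L) = 0"
    have "\<exists>x\<in>{0..real L}. f \<mu> x \<noteq> 0"
    proof (rule ccontr)
      assume "\<not> ?thesis"
      then have "g \<mu> 0 = 0" by (intro cell_ode_vanishing[OF ode[of \<mu>], of 0 "real L"]) (use Lpos in auto)
      then show False using g0[of \<mu>] by simp
    qed
    then show "dirichlet_eigenvalue (real L) (\<lambda>x. c \<lfloor>x\<rfloor>) \<mu>"
      unfolding dirichlet_eigenvalue_iff using z f0 ode by blast
  qed
  have nozero: "l > 0" if "x \<in> {0<..real L}" "f l x = 0" for l x
  proof (rule ccontr)
    assume "\<not> l > 0"
    then have "g l 0 = 0" 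
      by (intro nonneg_potential_no_second_zero[OF ode[of l] _ f0 that]) (use c in \<open>force\<close>)
    then show False using g0[of l] by simp
  qed
  define \<mu>1 where "\<mu>1 = \<kappa> + (pi / real m)\<^sup>2"
  have "\<exists>x\<in>{0<..real L}. f \<mu>1 x = 0"
    by (rule constant_run_has_zero[OF ode m]) (use run in \<open>auto simp: \<mu>1_def\<close>)
  then obtain x1 where x1: "x1 \<in> {0<..real L}" "f \<mu>1 x1 = 0" by blast
  have cont_x: "continuous_on {0..real L} (f l)" "continuous_on {0..real L} (g l)" for l
    using cell_odeD(1,2)[OF ode] by auto
  \<comment> \<open>Near the left end there is no zero, uniformly in the parameter, because the slope there is \<open>1\<close>;
    the set of zeros can therefore be taken compact.\<close>
  obtain \<delta> where \<delta>: "\<delta> > 0" "\<delta> \<le> real L" "\<And>l x. l \<in> {-1..\<mu>1} \<Longrightarrow> x \<in> {0<..\<delta>} \<Longrightarrow> f l x > 0"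
  proof -
    have "uniformly_continuous_on ({-1..\<mu>1} \<times> {0..real L}) (\<lambda>p. g (fst p) (snd p))"
      by (intro compact_uniformly_continuous compact_Times continuous_on_subset[OF cg]) auto
    then obtain d where d: "d > 0" and dd: "\<And>p p'. p \<in> {-1..\<mu>1} \<times> {0..real L} \<Longrightarrow> p' \<in> {-1..\<mu>1} \<times> {0..real L} \<Longrightarrow>
        dist p' p < d \<Longrightarrow> dist (g (fst p') (snd p')) (g (fst p) (snd p)) < 1"
      unfolding uniformly_continuous_on_def by (metis zero_less_one)
    define \<delta> where "\<delta> = min (d / 2) (real L)"
    have \<delta>: "\<delta> > 0" "\<delta> \<le> real L" "\<delta> < d" using d Lpos by (auto simp: \<delta>_def)
    have "f l x > 0" if l: "l \<in> {-1..\<mu>1}" and x: "x \<in> {0<..\<delta>}" for l x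
    proof -
      have "f l 0 < f l x"
      proof (rule DERIV_pos_imp_increasing_open[where f="f l"])
        fix t assume t: "0 < t" "t < x"
        have "(f l has_real_derivative g l t) (at t)"
          using cell_ode_deriv_within[OF ode, of t l] t x \<delta> by (simp add: at_within_Icc_at)
        moreover have "dist (g l t) (g l 0) < 1"
          using dd[of "(l, 0)" "(l, t)"] l t x \<delta> by (simp add: dist_Pair_Pair)
        then have "g l t > 0" using g0[of l] by (simp add: dist_real_def abs_less_iff)
        ultimately show "\<exists>y. (f l has_real_derivative y) (at t) \<and> 0 < y" by blast
      qed (use x \<delta> in \<open>auto intro: continuous_on_subset[OF cont_x(1)]\<close>)
      then show ?thesis using f0[of l] by simp
    qed
    then show ?thesis using \<delta> that by blast
  qed
  \<comment> \<open>The lower limit \<open>-1\<close> only has to lie below all parameters with a zero, which are positive.\<close>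
  define K where "K = {p \<in> {-1..\<mu>1} \<times> {\<delta>..real L}. f (fst p) (snd p) = 0}"
  have inK: "(l, x) \<in> K" if "l \<le> \<mu>1" "x \<in> {0<..real L}" "f l x = 0" for l x
    using nozero[OF that(2,3)] \<delta>(3)[of l x] that unfolding K_def by force
  have "compact K"
  proof -
    have "compact ({-1..\<mu>1} \<times> {\<delta>..real L})" by (intro compact_Times) auto
    moreover have "closed ({-1..\<mu>1} \<times> {\<delta>..real L} \<inter> (\<lambda>p. f (fst p) (snd p)) -` {0})"
      by (intro continuous_closed_preimage continuous_on_subset[OF cf] closed_Times) (use \<delta>(1) in auto)
    moreover have "K = ({-1..\<mu>1} \<times> {\<delta>..real L}) \<inter> ({-1..\<mu>1} \<times> {\<delta>..real L} \<inter> (\<lambda>p. f (fst p) (snd p)) -` {0})"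
      unfolding K_def by auto
    ultimately show ?thesis by (metis compact_Int_closed)
  qed
  moreover have "K \<noteq> {}" using inK[of \<mu>1 x1] x1 by auto
  ultimately have "\<exists>p\<in>K. \<forall>p'\<in>K. fst p \<le> fst p'"
    by (intro continuous_attains_inf continuous_on_fst continuous_on_id)
  then obtain p where p: "p \<in> K" "\<And>p'. p' \<in> K \<Longrightarrow> fst p \<le> fst p'" by blast
  obtain l x where lx: "p = (l, x)" by (cases p)
  have x: "x \<in> {\<delta>..real L}" "f l x = 0" and l: "l \<le> \<mu>1" using p(1) by (auto simp: lx K_def)
  have lpos: "l > 0" using nozero[of x l] x \<delta> by auto
  have "f l (real L) = 0"
  proof (rule ccontr)
    assume "f l (real L) \<noteq> 0"
    then have xL: "0 < x" "x < real L" using x \<delta> by (auto simp: less_le)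
    have gx: "g l x \<noteq> 0"
      using cell_ode_zero_data(2)[OF ode[of l], of x 0] x xL g0[of l] by auto
    have Dx: "(f l has_real_derivative g l x) (at x)"
      using cell_ode_deriv_within[OF ode, of x l] xL by (simp add: at_within_Icc_at)
    have "\<exists>y. y \<in> {0<..<real L} \<and> f l y < 0"
    proof (cases "g l x > 0")
      case True
      then obtain d where d: "d > 0" "\<And>h. 0 < h \<Longrightarrow> h < d \<Longrightarrow> f l (x - h) < f l x"
        using DERIV_pos_inc_left[OF Dx] by blast
      show ?thesis
        using d(2)[of "min (d / 2) (x / 2)"] d(1) xL x
        by (intro exI[of _ "x - min (d / 2) (x / 2)"]) (auto simp: min_def)
    next
      case False
      then obtain d where d: "d > 0" "\<And>h. 0 < h \<Longrightarrow> h < d \<Longrightarrow> f l x > f l (x + h)"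
        using DERIV_neg_dec_right[OF Dx] gx by force
      show ?thesis
        using d(2)[of "min (d / 2) ((real L - x) / 2)"] d(1) xL x
        by (intro exI[of _ "x + min (d / 2) ((real L - x) / 2)"]) (auto simp: min_def field_simps)
    qed
    then obtain y where y: "y \<in> {0<..<real L}" "f l y < 0" by blast
    have "continuous_on UNIV (\<lambda>l. f l y)"
      by (rule continuous_on_compose2[OF cf, of _ "\<lambda>l. (l, y)", simplified])
        (use y in \<open>auto intro!: continuous_intros\<close>)
    then have "((\<lambda>l. f l y) \<longlongrightarrow> f l y) (at_left l)"
      by (simp add: continuous_on_eq_continuous_at isCont_def filterlim_at_split)
    then have "\<forall>\<^sub>F l' in at_left l. f l' y < 0"
      using y(2) by (rule order_tendstoD)
    moreover have "\<forall>\<^sub>F l' in at_left l. l' \<in> {0<..<l}"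
      using lpos by (rule eventually_at_left_real)
    ultimately have "\<forall>\<^sub>F l' in at_left l. f l' y < 0 \<and> l' \<in> {0<..<l}" by (rule eventually_conj)
    then obtain l' where l': "f l' y < 0" "0 < l'" "l' < l"
      using eventually_happens[of _ "at_left l"] by (auto simp: trivial_limit_at_left_real)
    have "f l' \<delta> > 0" using \<delta>(1) \<delta>(3)[of l' \<delta>] l l' by auto
    have "\<delta> < y"
      using \<delta>(3)[of l' y] l l' y by force
    then obtain z where "\<delta> \<le> z" "z \<le> y" "f l' z = 0"
      using IVT2'[of "f l'" y 0 \<delta>] \<open>f l' \<delta> > 0\<close> l'(1) continuous_on_subset[OF cont_x(1)[of l'], of "{\<delta>..y}"] y \<delta>(1) by auto
    then have "l \<le> l'" using p(2)[OF inK[of l' z]] l l' y \<delta>(1) by (auto simp: lx)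
    then show False using l' by simp
  qed
  moreover have "l \<le> \<mu>" if "f \<mu> (real L) = 0" for \<mu>
  proof (cases "\<mu> \<le> \<mu>1")
    case True
    then show ?thesis using p(2)[OF inK[of \<mu> "real L"]] that Lpos by (simp add: lx)
  next
    case False
    then show ?thesis using l by simp
  qed
  ultimately show ?thesis using l unfolding eigen \<mu>1_def by blast
qed

lemma ground_state_energy_properties:
  fixes c :: "int \<Rightarrow> real" and L a m :: nat and \<kappa> :: real
  assumes c: "\<And>j. j \<in> {0..<int L} \<Longrightarrow> c j \<ge> 0" and m: "m > 0" "a + m \<le> L"
    and run: "\<And>j. j \<in> {int a..<int (a + m)} \<Longrightarrow> c j = \<kappa>"
  defines "E \<equiv> ground_state_energy (real L) (\<lambda>x. c \<lfloor>x\<rfloor>)"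
  shows "dirichlet_eigenvalue (real L) (\<lambda>x. c \<lfloor>x\<rfloor>) E" "E \<le> \<kappa> + (pi / real m)\<^sup>2"
proof -
  obtain E0 where l: "dirichlet_eigenvalue (real L) (\<lambda>x. c \<lfloor>x\<rfloor>) E0"
    "\<And>\<mu>. dirichlet_eigenvalue (real L) (\<lambda>x. c \<lfloor>x\<rfloor>) \<mu> \<Longrightarrow> E0 \<le> \<mu>" "E0 \<le> \<kappa> + (pi / real m)\<^sup>2"
    using ground_state_exists[of L c m a \<kappa>] c m run by blast
  have "E = E0" unfolding E_def ground_state_energy_def
    by (rule Least_equality) (use l in auto)
  then show "dirichlet_eigenvalue (real L) (\<lambda>x. c \<lfloor>x\<rfloor>) E" "E \<le> \<kappa> + (pi / real m)\<^sup>2"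
    using l by auto
qed

section \<open>Lower bounds for eigenvalues, and the landscape function\<close>

text \<open>
  A positive supersolution \<open>\<phi>\<close> of \<open>- \<phi>'' + c \<phi> = A \<phi>\<close> bounds the eigenvalues from below by
  \<open>A\<close>; here it is replaced by its logarithmic derivative \<open>\<rho> = \<phi>' / \<phi>\<close>. Only the inequality
  \<open>\<rho>' + \<rho>\<^sup>2 \<le> c - A\<close> matters, and concave kinks of \<open>\<phi>\<close> become downward jumps of \<open>\<rho>\<close>,
  so a subsolution can be chosen on each cell separately. For an eigenfunction \<open>f\<close> the quantity
  \<open>f f' - \<rho> f\<^sup>2\<close> vanishes at both ends, increases across the jumps, and has derivative at least
  \<open>(A - \<mu>) f\<^sup>2\<close> within the cells; this is impossible for \<open>\<mu> < A\<close>.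
\<close>

lemma eigenvalue_ge_if_riccati_subsolution:
  fixes c :: "int \<Rightarrow> real" and \<rho> \<rho>' :: "nat \<Rightarrow> real \<Rightarrow> real"
  assumes eig: "dirichlet_eigenvalue (real L) (\<lambda>x. c \<lfloor>x\<rfloor>) \<mu>" and L: "L > 0"
    and D\<rho>: "\<And>j x. j < L \<Longrightarrow> x \<in> {real j..real j + 1} \<Longrightarrow> (\<rho> j has_real_derivative \<rho>' j x) (at x)"
    and riccati: "\<And>j x. j < L \<Longrightarrow> x \<in> {real j..real j + 1} \<Longrightarrow> \<rho>' j x + (\<rho> j x)\<^sup>2 \<le> c (int j) - A"
    and jump: "\<And>j. Suc j < L \<Longrightarrow> \<rho> (Suc j) (real (Suc j)) \<le> \<rho> j (real (Suc j))"
  shows "A \<le> \<mu>"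
proof (rule ccontr)
  assume "\<not> A \<le> \<mu>"
  then have "A - \<mu> > 0" by simp
  obtain f f' where ode: "cell_ode L (\<lambda>j. c j - \<mu>) 0 f f'" and f: "f 0 = 0" "f (real L) = 0" "\<exists>x\<in>{0..real L}. f x \<noteq> 0"
    using eig unfolding dirichlet_eigenvalue_iff by blast
  define S where "S = \<int> \<inter> {0..real L}"
  have S: "finite S" unfolding S_def by (rule finite_Ints_Icc)
  note D = cell_odeD[OF ode, folded S_def]
  \<comment> \<open>The area below \<open>f\<^sup>2\<close>, subtracted in \<open>F\<close> below, keeps the strict gain \<open>(A - \<mu>) f\<^sup>2\<close> that
    monotonicity alone would lose.\<close>
  define H where "H x = integral {0..x} (\<lambda>x. (f x)\<^sup>2)" for x
  have cf2: "continuous_on {0..real L} (\<lambda>x. (f x)\<^sup>2)" by (intro continuous_intros D(1))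
  have DH: "(H has_real_derivative (f x)\<^sup>2) (at x within {0..real L})" if "x \<in> {0..real L}" for x
    unfolding H_def by (rule integral_has_real_derivative[OF cf2 that])
  then have cH: "continuous_on {0..real L} H" by (rule DERIV_continuous_on)
  define F where "F j x = f x * f' x - \<rho> j x * (f x)\<^sup>2 - (A - \<mu>) * H x" for j x
  have mono: "F j (real j) \<le> F j (real (Suc j))" if j: "j < L" for j
  proof (rule mono_except_finite[OF S, where G="F j" and
        g="\<lambda>x. (f' x - \<rho> j x * f x)\<^sup>2 + (c (int j) - A - (\<rho>' j x + (\<rho> j x)\<^sup>2)) * (f x)\<^sup>2"])
    have "continuous_on {real j..real (Suc j)} (\<rho> j)"
      by (intro continuous_at_imp_continuous_on ballI DERIV_isCont[OF D\<rho>[OF j]]) auto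
    then show "continuous_on {real j..real (Suc j)} (F j)"
      unfolding F_def using j
      by (intro continuous_intros continuous_on_subset[OF D(1)] continuous_on_subset[OF D(2)]
          continuous_on_subset[OF cH]) auto
    fix x assume x0: "x \<in> {real j<..<real (Suc j)} - S"
    have x: "x \<in> {0<..<real L} - S" using x0 j by auto
    have fl: "\<lfloor>x\<rfloor> = int j" using x0 by (intro floor_unique) auto
    have dH: "(H has_real_derivative (f x)\<^sup>2) (at x)"
      using DH[of x] x by (simp add: at_within_Icc_at)
    have d\<rho>: "(\<rho> j has_real_derivative \<rho>' j x) (at x)" using D\<rho>[OF j] x0 by auto
    show "(F j has_real_derivative (f' x - \<rho> j x * f x)\<^sup>2 + (c (int j) - A - (\<rho>' j x + (\<rho> j x)\<^sup>2)) * (f x)\<^sup>2) (at x)"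
      unfolding F_def
      by (rule derivative_eq_intros D(3,4) dH d\<rho> x refl)+ (simp add: fl algebra_simps power2_eq_square)
    show "0 \<le> (f' x - \<rho> j x * f x)\<^sup>2 + (c (int j) - A - (\<rho>' j x + (\<rho> j x)\<^sup>2)) * (f x)\<^sup>2"
      using riccati[OF j, of x] x0 by (intro add_nonneg_nonneg mult_nonneg_nonneg) auto
  qed simp
  have "0 \<le> F j (real (Suc j))" if "j < L" for j
    using that
  proof (induction j)
    case 0
    then show ?case using mono[of 0] f(1) by (simp add: F_def H_def)
  next
    case (Suc j)
    have "\<rho> (Suc j) (real (Suc j)) * (f (real (Suc j)))\<^sup>2 \<le> \<rho> j (real (Suc j)) * (f (real (Suc j)))\<^sup>2"
      by (rule mult_right_mono[OF jump[OF Suc.prems]]) simp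
    then have "F j (real (Suc j)) \<le> F (Suc j) (real (Suc j))" unfolding F_def by linarith
    also have "\<dots> \<le> F (Suc j) (real (Suc (Suc j)))" by (rule mono[OF Suc.prems])
    finally show ?case using Suc by simp
  qed
  from this[of "L - 1"] have "0 \<le> - ((A - \<mu>) * H (real L))" using L f(2) by (simp add: F_def)
  then have "H (real L) \<le> 0" using \<open>A - \<mu> > 0\<close> by (simp add: mult_le_0_iff)
  moreover have "H (real L) \<ge> 0" unfolding H_def by (rule integral_nonneg) (use cf2 in \<open>auto intro: integrable_continuous_real\<close>)
  ultimately have "H (real L) = 0" by simp
  then have "\<forall>x\<in>{0..real L}. (f x)\<^sup>2 = 0"
    unfolding H_def using integral_eq_0_iff[OF cf2] L by simp
  then show False using f(3) by simp
qed

lemma cell_ode_cong: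
  assumes "cell_ode L q r f f'" "\<And>x. x \<in> {0..real L} \<Longrightarrow> f x = h x"
  shows "cell_ode L q r h f'"
  unfolding cell_ode_def
proof (intro conjI ballI)
  show "continuous_on {0..real L} h"
    using continuous_on_eq[OF cell_odeD(1)[OF assms(1)] assms(2)] .
  show "continuous_on {0..real L} f'" using assms by (simp add: cell_ode_def)
  fix x assume x: "x \<in> {0<..<real L} - \<int>"
  have "(f has_real_derivative f' x) (at x)" "(f' has_real_derivative q \<lfloor>x\<rfloor> * f x - r) (at x)"
    using assms(1) x by (auto simp: cell_ode_def)
  then show "(h has_real_derivative f' x) (at x)" "(f' has_real_derivative q \<lfloor>x\<rfloor> * h x - r) (at x)"
    using has_field_derivative_transform_within_open[of f "f' x" x "{0<..<real L}" h] assms(2) x by auto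
qed

text \<open>
  The comparison functions needed for the landscape are all of the form
  \<open>C + B (x - a) (b - x)\<close>, including constants.
\<close>

lemma landscape_ge_parabola:
  assumes ode: "cell_ode L c 1 u u'" and c: "\<And>j. j \<in> {0..<int L} \<Longrightarrow> c j \<ge> 0"
    and ab: "0 \<le> a" "b \<le> real L" "u a \<ge> C" "u b \<ge> C"
    and sub: "\<And>x. x \<in> {a<..<b} \<Longrightarrow> 2 * B + c \<lfloor>x\<rfloor> * (C + B * ((x - a) * (b - x))) \<le> 1"
    and x: "x \<in> {a..b}"
  shows "C + B * ((x - a) * (b - x)) \<le> u x"
proof -
  define S where "S = \<int> \<inter> {0..real L}"
  have S: "finite S" unfolding S_def by (rule finite_Ints_Icc)
  note D = cell_odeD[OF ode, folded S_def]
  have "0 \<le> u x - (C + B * ((x - a) * (b - x)))"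
  proof (rule comparison_principle[OF S, where w="\<lambda>x. u x - (C + B * ((x - a) * (b - x)))" and b=b and a=a
        and w'="\<lambda>x. u' x - B * (a + b - 2 * x)" and w''="\<lambda>x. c \<lfloor>x\<rfloor> * u x - 1 + 2 * B" and q="\<lambda>x. c \<lfloor>x\<rfloor>"])
    show "continuous_on {a..b} (\<lambda>x. u x - (C + B * ((x - a) * (b - x))))"
      "continuous_on {a..b} (\<lambda>x. u' x - B * (a + b - 2 * x))"
      using ab by (auto intro!: continuous_intros continuous_on_subset[OF D(1)] continuous_on_subset[OF D(2)])
    fix t assume t0: "t \<in> {a<..<b} - S"
    have t: "t \<in> {0<..<real L} - S" using t0 ab by auto
    show "((\<lambda>x. u x - (C + B * ((x - a) * (b - x)))) has_real_derivative u' t - B * (a + b - 2 * t)) (at t)"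
      by (rule derivative_eq_intros D(3) t refl)+ (simp add: algebra_simps)
    show "((\<lambda>x. u' x - B * (a + b - 2 * x)) has_real_derivative c \<lfloor>t\<rfloor> * u t - 1 + 2 * B) (at t)"
      by (rule derivative_eq_intros D(4) t refl)+ (simp add: algebra_simps)
    show "c \<lfloor>t\<rfloor> * u t - 1 + 2 * B \<le> c \<lfloor>t\<rfloor> * (u t - (C + B * ((t - a) * (b - t))))"
      using sub[of t] t0 unfolding right_diff_distrib by auto
    show "c \<lfloor>t\<rfloor> \<ge> 0" using t by (intro c) (auto simp: floor_less_iff)
  qed (use ab x in auto)
  then show ?thesis by simp
qed

lemma landscape_le_parabola:
  assumes ode: "cell_ode L c 1 u u'" and c: "\<And>j. j \<in> {0..<int L} \<Longrightarrow> c j \<ge> 0"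
    and ab: "0 \<le> a" "b \<le> real L" "u a \<le> C" "u b \<le> C"
    and sup: "\<And>x. x \<in> {a<..<b} \<Longrightarrow> 2 * B + c \<lfloor>x\<rfloor> * (C + B * ((x - a) * (b - x))) \<ge> 1"
    and x: "x \<in> {a..b}"
  shows "u x \<le> C + B * ((x - a) * (b - x))"
proof -
  define S where "S = \<int> \<inter> {0..real L}"
  have S: "finite S" unfolding S_def by (rule finite_Ints_Icc)
  note D = cell_odeD[OF ode, folded S_def]
  have "0 \<le> (C + B * ((x - a) * (b - x))) - u x"
  proof (rule comparison_principle[OF S, where w="\<lambda>x. (C + B * ((x - a) * (b - x))) - u x" and b=b and a=a
        and w'="\<lambda>x. B * (a + b - 2 * x) - u' x" and w''="\<lambda>x. - (c \<lfloor>x\<rfloor> * u x - 1 + 2 * B)" and q="\<lambda>x. c \<lfloor>x\<rfloor>"])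
    show "continuous_on {a..b} (\<lambda>x. (C + B * ((x - a) * (b - x))) - u x)"
      "continuous_on {a..b} (\<lambda>x. B * (a + b - 2 * x) - u' x)"
      using ab by (auto intro!: continuous_intros continuous_on_subset[OF D(1)] continuous_on_subset[OF D(2)])
    fix t assume t0: "t \<in> {a<..<b} - S"
    have t: "t \<in> {0<..<real L} - S" using t0 ab by auto
    show "((\<lambda>x. (C + B * ((x - a) * (b - x))) - u x) has_real_derivative B * (a + b - 2 * t) - u' t) (at t)"
      by (rule derivative_eq_intros D(3) t refl)+ (simp add: algebra_simps)
    show "((\<lambda>x. B * (a + b - 2 * x) - u' x) has_real_derivative - (c \<lfloor>t\<rfloor> * u t - 1 + 2 * B)) (at t)"
      by (rule derivative_eq_intros D(4) t refl)+ (simp add: algebra_simps)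
    show "- (c \<lfloor>t\<rfloor> * u t - 1 + 2 * B) \<le> c \<lfloor>t\<rfloor> * ((C + B * ((t - a) * (b - t))) - u t)"
      using sup[of t] t0 unfolding right_diff_distrib by auto
    show "c \<lfloor>t\<rfloor> \<ge> 0" using t by (intro c) (auto simp: floor_less_iff)
  qed (use ab x in auto)
  then show ?thesis by simp
qed

text \<open>
  A sufficiently flat parabola over the whole interval is a subsolution.
\<close>

lemma landscape_solution_pos:
  assumes ode: "cell_ode L c 1 u u'" and c: "\<And>j. j \<in> {0..<int L} \<Longrightarrow> c j \<ge> 0"
    and "u 0 = 0" "u (real L) = 0" and x: "x \<in> {0<..<real L}"
  shows "u x > 0"
proof -
  define K where "K = (\<Sum>j\<in>{0..<int L}. c j)"
  have K: "K \<ge> 0" unfolding K_def using c by (intro sum_nonneg) auto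
  \<comment> \<open>\<open>K\<close> bounds the potential and \<open>L\<^sup>2\<close> the parabola, so \<open>2 B + c B x (L - x) \<le> 1\<close>.\<close>
  define B where "B = 1 / (2 + K * (real L)\<^sup>2)"
  have pos: "2 + K * (real L)\<^sup>2 > 0" using K by (intro add_pos_nonneg) auto
  then have B: "B > 0" by (simp add: B_def)
  have "0 + B * ((x - 0) * (real L - x)) \<le> u x"
  proof (rule landscape_ge_parabola[OF ode c])
    fix t assume t: "t \<in> {0<..<real L}"
    then have fl: "\<lfloor>t\<rfloor> \<in> {0..<int L}" by (auto simp: floor_less_iff)
    have "c \<lfloor>t\<rfloor> \<le> K" unfolding K_def using c fl by (intro member_le_sum) auto
    moreover have "t * (real L - t) \<le> real L * real L" using t by (intro mult_mono) auto
    ultimately have "c \<lfloor>t\<rfloor> * (t * (real L - t)) \<le> K * (real L)\<^sup>2"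
      unfolding power2_eq_square using t K c[OF fl] by (intro mult_mono) auto
    then have "B * (2 + c \<lfloor>t\<rfloor> * (t * (real L - t))) \<le> B * (2 + K * (real L)\<^sup>2)" using B by simp
    also have "\<dots> = 1" using pos by (simp add: B_def)
    finally show "2 * B + c \<lfloor>t\<rfloor> * (0 + B * ((t - 0) * (real L - t))) \<le> 1" by (simp add: algebra_simps)
  qed (use assms in auto)
  moreover have "B * (x * (real L - x)) > 0" using B x by simp
  ultimately show ?thesis by simp
qed

text \<open>
  A solution of the inhomogeneous equation exists by shooting. Its value at \<open>L\<close> can be corrected by
  a multiple of the homogeneous solution, because the latter has no zero there.
\<close>

lemma landscape_properties:
  fixes c :: "int \<Rightarrow> real" and L :: nat
  assumes c: "\<And>j. j \<in> {0..<int L} \<Longrightarrow> c j \<ge> 0" and L: "L > 0"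
  shows "\<exists>u u'. cell_ode L c 1 u u' \<and> u 0 = 0 \<and> u (real L) = 0 \<and>
    (\<forall>x\<in>{0<..<real L}. u x > 0) \<and> landscape (real L) (\<lambda>x. c \<lfloor>x\<rfloor>) = u"
proof -
  have iff: "schroedinger_dirichlet (real L) (\<lambda>x. c \<lfloor>x\<rfloor>) v (\<lambda>_. 1) \<longleftrightarrow>
      v 0 = 0 \<and> v (real L) = 0 \<and> (\<exists>v'. cell_ode L c 1 v v')" for v
    using schroedinger_dirichlet_iff[of L c v 0 1] by simp
  obtain y y' where y: "y 0 = 0" "cell_ode L c 1 y y'"
  proof -
    obtain F G where "\<forall>l. F l 0 = 0 \<and> G l 0 = 0 \<and> cell_ode L (\<lambda>j. c j - l) 1 (F l) (G l)"
      using shooting_solution[of L 0 0 c 1] by blast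
    from this[rule_format, of 0] show ?thesis using that[of "F 0" "G 0"] by simp
  qed
  obtain h h' where h: "h 0 = 0" "h' 0 = 1" "cell_ode L c 0 h h'"
  proof -
    obtain F G where "\<forall>l. F l 0 = 0 \<and> G l 0 = 1 \<and> cell_ode L (\<lambda>j. c j - l) 0 (F l) (G l)"
      using shooting_solution[of L 0 1 c 0] by blast
    from this[rule_format, of 0] show ?thesis using that[of "F 0" "G 0"] by simp
  qed
  have hL: "h (real L) \<noteq> 0"
    using nonneg_potential_no_second_zero[OF h(3) c h(1), of "real L"] h(2) L by auto
  define k where "k = y (real L) / h (real L)"
  define u where "u x = (if x \<in> {0..real L} then y x - k * h x else 0)" for x
  define u' where "u' x = y' x - k * h' x" for x
  have "cell_ode L c 1 (\<lambda>x. y x - k * h x) u'"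
    unfolding u'_def using cell_ode_cmult_diff[OF y(2) h(3), of k] by simp
  then have ode: "cell_ode L c 1 u u'"
    by (rule cell_ode_cong) (simp add: u_def)
  have u0: "u 0 = 0" "u (real L) = 0"
    using y h hL by (auto simp: u_def k_def)
  have land: "landscape (real L) (\<lambda>x. c \<lfloor>x\<rfloor>) = u"
    unfolding landscape_def iff
  proof (rule the_equality)
    show "(\<forall>x. x \<notin> {0..real L} \<longrightarrow> u x = 0) \<and> u 0 = 0 \<and> u (real L) = 0 \<and> (\<exists>v'. cell_ode L c 1 u v')"
      using u0 ode by (auto simp: u_def)
    fix v assume v: "(\<forall>x. x \<notin> {0..real L} \<longrightarrow> v x = 0) \<and> v 0 = 0 \<and> v (real L) = 0 \<and> (\<exists>v'. cell_ode L c 1 v v')"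
    then obtain v' where v': "cell_ode L c 1 v v'" by blast
    have d: "cell_ode L c 0 (\<lambda>x. v x - 1 * u x) (\<lambda>x. v' x - 1 * u' x)"
      using cell_ode_cmult_diff[OF v' ode, of 1] by simp
    have "v' 0 - 1 * u' 0 = 0"
      by (rule nonneg_potential_no_second_zero[OF d c, of "real L"]) (use v u0 L in auto)
    then have eq: "v x - 1 * u x = 0" if "x \<in> {0..real L}" for x
      using cell_ode_zero_data(1)[OF d, of 0 x] v u0 that by auto
    show "v = u"
    proof
      fix x
      show "v x = u x"
      proof (cases "x \<in> {0..real L}")
        case True
        then show ?thesis using eq[of x] by simp
      next
        case False
        then have "v x = 0" using v by blast
        then show ?thesis using False by (simp only: u_def if_False)
      qed
    qed
  qed
  have "\<forall>x\<in>{0<..<real L}. u x > 0"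
    by (intro ballI landscape_solution_pos[OF ode c u0])
  then show ?thesis using ode u0 land by blast
qed

lemma min_inverse_landscape_properties:
  fixes c :: "int \<Rightarrow> real" and L :: nat
  assumes c: "\<And>j. j \<in> {0..<int L} \<Longrightarrow> c j \<ge> 0" and L: "L > 0"
  shows "\<exists>u u' x0. cell_ode L c 1 u u' \<and> u 0 = 0 \<and> u (real L) = 0 \<and>
    (\<forall>x\<in>{0..real L}. 0 \<le> u x \<and> u x \<le> u x0) \<and> x0 \<in> {0<..<real L} \<and>
    min_inverse_landscape (real L) (\<lambda>x. c \<lfloor>x\<rfloor>) = 1 / u x0"
proof -
  have "\<exists>u u'. cell_ode L c 1 u u' \<and> u 0 = 0 \<and> u (real L) = 0 \<and>
      (\<forall>x\<in>{0<..<real L}. u x > 0) \<and> landscape (real L) (\<lambda>x. c \<lfloor>x\<rfloor>) = u"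
    by (rule landscape_properties) (use c L in auto)
  then obtain u u' where ode: "cell_ode L c 1 u u'" and u0: "u 0 = 0" "u (real L) = 0"
    and pos: "\<And>x. x \<in> {0<..<real L} \<Longrightarrow> u x > 0" and land: "landscape (real L) (\<lambda>x. c \<lfloor>x\<rfloor>) = u"
    by blast
  have "\<exists>x0\<in>{0..real L}. \<forall>x\<in>{0..real L}. u x \<le> u x0"
    using cell_odeD(1)[OF ode] by (intro continuous_attains_sup) auto
  then obtain x0 where x0: "x0 \<in> {0..real L}" "\<And>x. x \<in> {0..real L} \<Longrightarrow> u x \<le> u x0" by blast
  have "u x0 > 0" using pos[of "real L / 2"] x0(2)[of "real L / 2"] L by simp
  then have "x0 \<noteq> 0" "x0 \<noteq> real L" using u0 by auto
  then have x0i: "x0 \<in> {0<..<real L}" using x0(1) by simp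
  have inv: "min_inverse_landscape (real L) (\<lambda>x. c \<lfloor>x\<rfloor>) = 1 / u x0"
    unfolding min_inverse_landscape_def land
  proof (rule Least_equality)
    show "1 / u x0 \<in> (\<lambda>x. 1 / u x) ` {0<..<real L}" using x0i by blast
    fix m assume "m \<in> (\<lambda>x. 1 / u x) ` {0<..<real L}"
    then obtain x where "x \<in> {0<..<real L}" "m = 1 / u x" by blast
    then show "1 / u x0 \<le> m" using pos[of x] x0(2)[of x] by (simp add: frac_le)
  qed
  have nonneg: "0 \<le> u x" if "x \<in> {0..real L}" for x
  proof (cases "x = 0 \<or> x = real L")
    case False
    then have "x \<in> {0<..<real L}" using that by auto
    then show ?thesis using pos by (intro less_imp_le)
  qed (use u0 in auto)
  have "\<forall>x\<in>{0..real L}. 0 \<le> u x \<and> u x \<le> u x0" using nonneg x0(2) by blast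
  then show ?thesis using ode u0 x0i inv by blast
qed

section \<open>Bounds for high potentials\<close>

lemma parabola_le: "(x - a) * (b - x) \<le> (b - a)\<^sup>2 / (4::real)"
  using zero_le_power2[of "2 * x - a - b"] by (simp add: power2_eq_square algebra_simps)

text \<open>
  The bound is the height of a parabola on the run, scaled so that it is a subsolution for the
  potential \<open>\<kappa>\<close>. For \<open>\<kappa> = 0\<close> it is the exact value \<open>m\<^sup>2 / 8\<close>, and for large \<open>\<kappa>\<close> it is close
  to \<open>1 / \<kappa>\<close>, so the same lemma serves both limits.
\<close>

lemma landscape_max_ge_run:
  assumes ode: "cell_ode L c 1 u u'" and c: "\<And>j. j \<in> {0..<int L} \<Longrightarrow> c j \<ge> 0"
    and nonneg: "\<And>x. x \<in> {0..real L} \<Longrightarrow> 0 \<le> u x" and m: "m > 0" "a + m \<le> L"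
    and run: "\<And>j. j \<in> {int a..<int (a + m)} \<Longrightarrow> c j = \<kappa>"
  shows "1 / (\<kappa> + 8 / (real m)\<^sup>2) \<le> u (real a + real m / 2)"
proof -
  have "c (int a) = \<kappa>" "c (int a) \<ge> 0" using run[of "int a"] c[of "int a"] m by auto
  then have \<kappa>: "\<kappa> \<ge> 0" by simp
  define P where "P = \<kappa> + 8 / (real m)\<^sup>2"
  have P: "P > 0" unfolding P_def using \<kappa> m by (intro add_nonneg_pos) auto
  define B where "B = 4 / (real m)\<^sup>2 / P"
  have B: "B \<ge> 0" using P by (simp add: B_def)
  have Bm: "B * ((real m)\<^sup>2 / 4) = 1 / P" using m by (simp add: B_def)
  have "0 + B * ((real a + real m / 2 - real a) * (real (a + m) - (real a + real m / 2))) \<le> u (real a + real m / 2)"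
  proof (rule landscape_ge_parabola[OF ode c])
    fix x assume x: "x \<in> {real a<..<real (a + m)}"
    have "\<lfloor>x\<rfloor> \<in> {int a..<int (a + m)}" using x by (auto simp: floor_less_iff le_floor_iff)
    then have c\<kappa>: "c \<lfloor>x\<rfloor> = \<kappa>" by (rule run)
    have "B * ((x - real a) * (real (a + m) - x)) \<le> B * ((real m)\<^sup>2 / 4)"
      using parabola_le[of x "real a" "real (a + m)"] B by (intro mult_left_mono) auto
    then have "\<kappa> * (B * ((x - real a) * (real (a + m) - x))) \<le> \<kappa> * (1 / P)"
      unfolding Bm using \<kappa> by (rule mult_left_mono)
    moreover have "2 * B + \<kappa> * (1 / P) = (\<kappa> + 8 / (real m)\<^sup>2) / P"
      by (simp add: B_def add_divide_distrib)
    then have "2 * B + \<kappa> * (1 / P) = P / P" by (simp only: P_def)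
    ultimately show "2 * B + c \<lfloor>x\<rfloor> * (0 + B * ((x - real a) * (real (a + m) - x))) \<le> 1"
      using P by (simp add: c\<kappa>)
  qed (use m nonneg in auto)
  then show ?thesis using Bm by (simp add: P_def power2_eq_square)
qed

lemma landscape_le_inverse_potential:
  assumes ode: "cell_ode L c 1 u u'" and \<kappa>: "\<kappa> > 0" "\<And>j. j \<in> {0..<int L} \<Longrightarrow> c j \<ge> \<kappa>"
    and u0: "u 0 = 0" "u (real L) = 0" and x: "x \<in> {0..real L}"
  shows "u x \<le> 1 / \<kappa>"
proof -
  have "u x \<le> 1 / \<kappa> + 0 * ((x - 0) * (real L - x))"
  proof (rule landscape_le_parabola[OF ode])
    fix j assume "j \<in> {0..<int L}" then show "0 \<le> c j" using \<kappa> by force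
  next
    fix t assume "t \<in> {0<..<real L}"
    then have "c \<lfloor>t\<rfloor> \<ge> \<kappa>" by (intro \<kappa>) (auto simp: floor_less_iff)
    then show "1 \<le> 2 * 0 + c \<lfloor>t\<rfloor> * (1 / \<kappa> + 0 * ((t - 0) * (real L - t)))" using \<kappa>(1) by (simp add: field_simps)
  qed (use \<kappa> u0 x in auto)
  then show ?thesis by simp
qed

text \<open>
  Since \<open>u'' = c u - 1 \<ge> -1\<close>, the function \<open>u' + x\<close> increases. The bound follows from the signs
  of \<open>u'\<close> at the two ends, where the nonnegative function \<open>u\<close> vanishes. It does not depend on the
  height of the potential.
\<close>

lemma landscape_deriv_bound:
  assumes ode: "cell_ode L c 1 u u'" and c: "\<And>j. j \<in> {0..<int L} \<Longrightarrow> c j \<ge> 0" and L: "L > 0"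
    and nonneg: "\<And>x. x \<in> {0..real L} \<Longrightarrow> 0 \<le> u x" and u0: "u 0 = 0" "u (real L) = 0"
    and x: "x \<in> {0..real L}"
  shows "\<bar>u' x\<bar> \<le> real L"
proof -
  define S where "S = \<int> \<inter> {0..real L}"
  have S: "finite S" unfolding S_def by (rule finite_Ints_Icc)
  note D = cell_odeD[OF ode, folded S_def]
  have mono: "u' y + y \<le> u' z + z" if "0 \<le> y" "y \<le> z" "z \<le> real L" for y z
  proof (rule mono_except_finite[OF S, where G="\<lambda>x. u' x + x" and g="\<lambda>x. c \<lfloor>x\<rfloor> * u x"])
    show "continuous_on {y..z} (\<lambda>x. u' x + x)"
      using that by (intro continuous_intros continuous_on_subset[OF D(2)]) auto
    fix t assume "t \<in> {y<..<z} - S"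
    then have t: "t \<in> {0<..<real L} - S" using that by auto
    show "((\<lambda>x. u' x + x) has_real_derivative c \<lfloor>t\<rfloor> * u t) (at t)"
      by (rule derivative_eq_intros D(4) t refl)+ simp
    have "\<lfloor>t\<rfloor> \<in> {0..<int L}" using t by (auto simp: floor_less_iff)
    then show "0 \<le> c \<lfloor>t\<rfloor> * u t" using c nonneg[of t] t by simp
  qed (use that in auto)
  have "u' 0 \<ge> 0"
  proof (rule ccontr)
    assume "\<not> u' 0 \<ge> 0"
    then obtain d where d: "d > 0" "\<And>h. h > 0 \<Longrightarrow> 0 + h \<in> {0..real L} \<Longrightarrow> h < d \<Longrightarrow> u 0 > u (0 + h)"
      using has_real_derivative_neg_dec_right[OF cell_ode_deriv_within[OF ode, of 0]] by auto
    define h where "h = min (d / 2) (real L)"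
    have "h > 0" "h < d" "h \<le> real L" using d(1) L by (auto simp: h_def min_less_iff_disj)
    then show False using d(2)[of h] nonneg[of h] u0 by simp
  qed
  moreover have "u' (real L) \<le> 0"
  proof (rule ccontr)
    assume "\<not> u' (real L) \<le> 0"
    then obtain d where d: "d > 0" "\<And>h. h > 0 \<Longrightarrow> real L - h \<in> {0..real L} \<Longrightarrow> h < d \<Longrightarrow> u (real L - h) < u (real L)"
      using has_real_derivative_pos_inc_left[OF cell_ode_deriv_within[OF ode, of "real L"]] by auto
    define h where "h = min (d / 2) (real L)"
    have "h > 0" "h < d" "h \<le> real L" using d(1) L by (auto simp: h_def min_less_iff_disj)
    then show False using d(2)[of h] nonneg[of "real L - h"] u0 by simp
  qed
  ultimately show ?thesis
    using mono[of 0 x] mono[of x "real L"] x by (simp add: abs_le_iff)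
qed

text \<open>
  If \<open>u\<close> reached \<open>\<eta>\<close> on a wall, the derivative bound would keep it above \<open>\<eta> / 2\<close> on a part
  of the cell of length \<open>\<delta>\<close>. There \<open>u'' \<ge> K \<eta> / 2 - 1\<close>, so \<open>u'\<close> would vary by more than
  the \<open>2 L\<close> that the bound permits.
\<close>

lemma landscape_small_on_high_cell:
  assumes ode: "cell_ode L c 1 u u'" and c: "\<And>j. j \<in> {0..<int L} \<Longrightarrow> c j \<ge> 0" and L: "L > 0"
    and nonneg: "\<And>x. x \<in> {0..real L} \<Longrightarrow> 0 \<le> u x" and u0: "u 0 = 0" "u (real L) = 0"
    and j: "j < L" "K \<le> c (int j)" and x: "x \<in> {real j..real j + 1}"
    and \<delta>: "0 < \<delta>" "\<delta> \<le> 1 / 2" "real L * \<delta> \<le> \<eta> / 2" and K: "(K * \<eta> / 2 - 1) * \<delta> > 2 * real L" "K \<ge> 0"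
  shows "u x < \<eta>"
proof (rule ccontr)
  assume "\<not> u x < \<eta>"
  then have ux: "u x \<ge> \<eta>" by simp
  define S where "S = \<int> \<inter> {0..real L}"
  have S: "finite S" unfolding S_def by (rule finite_Ints_Icc)
  note D = cell_odeD[OF ode, folded S_def]
  have Lu: "\<bar>u' t\<bar> \<le> real L" if "t \<in> {0..real L}" for t
    by (rule landscape_deriv_bound[OF ode c L nonneg u0 that])
  have jL: "real j + 1 \<le> real L" using j by linarith
  have lip: "\<bar>u z - u y\<bar> \<le> real L * (z - y)" if "0 \<le> y" "y \<le> z" "z \<le> real L" for y z
  proof -
    have "u y + real L * y \<le> u z + real L * z"
    proof (rule mono_except_finite[OF S, where G="\<lambda>x. u x + real L * x" and g="\<lambda>x. u' x + real L"])
      fix t assume "t \<in> {y<..<z} - S"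
      then have t: "t \<in> {0<..<real L} - S" using \<open>0 \<le> y\<close> \<open>z \<le> real L\<close> by auto
      show "((\<lambda>x. u x + real L * x) has_real_derivative u' t + real L) (at t)"
        by (rule derivative_eq_intros D(3) t refl)+ simp
      show "0 \<le> u' t + real L" using Lu[of t] t by (simp add: abs_le_iff)
    qed (use \<open>0 \<le> y\<close> \<open>y \<le> z\<close> \<open>z \<le> real L\<close> in \<open>auto intro!: continuous_intros continuous_on_subset[OF D(1)]\<close>)
    moreover have "- u y + real L * y \<le> - u z + real L * z"
    proof (rule mono_except_finite[OF S, where G="\<lambda>x. - u x + real L * x" and g="\<lambda>x. - u' x + real L"])
      fix t assume "t \<in> {y<..<z} - S"
      then have t: "t \<in> {0<..<real L} - S" using \<open>0 \<le> y\<close> \<open>z \<le> real L\<close> by auto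
      show "((\<lambda>x. - u x + real L * x) has_real_derivative - u' t + real L) (at t)"
        by (rule derivative_eq_intros D(3) t refl)+ simp
      show "0 \<le> - u' t + real L" using Lu[of t] t by (simp add: abs_le_iff)
    qed (use \<open>0 \<le> y\<close> \<open>y \<le> z\<close> \<open>z \<le> real L\<close> in \<open>auto intro!: continuous_intros continuous_on_subset[OF D(1)]\<close>)
    ultimately show ?thesis by (auto simp: abs_le_iff algebra_simps)
  qed
  obtain p where p: "real j \<le> p" "p + \<delta> \<le> real j + 1" "x \<in> {p..p + \<delta>}"
  proof (cases "x \<le> real j + 1 / 2")
    case True
    then show ?thesis using that[of x] x \<delta> by auto
  next
    case False
    then show ?thesis using that[of "x - \<delta>"] x \<delta> by auto
  qed
  have large: "u t \<ge> \<eta> / 2" if t: "t \<in> {p..p + \<delta>}" for t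
  proof -
    have "\<bar>u t - u x\<bar> \<le> real L * \<delta>"
    proof (cases "t \<le> x")
      case True
      have "\<bar>u x - u t\<bar> \<le> real L * (x - t)" using True t p jL by (intro lip) auto
      also have "\<dots> \<le> real L * \<delta>" using t p by (intro mult_left_mono) auto
      finally show ?thesis by (simp add: abs_minus_commute)
    next
      case False
      have "\<bar>u t - u x\<bar> \<le> real L * (t - x)" using False t p jL by (intro lip) auto
      also have "\<dots> \<le> real L * \<delta>" using t p by (intro mult_left_mono) auto
      finally show ?thesis .
    qed
    then show ?thesis using ux \<delta>(3) by (simp add: abs_le_iff)
  qed
  define N where "N = K * \<eta> / 2 - 1"
  have "u' p - N * p \<le> u' (p + \<delta>) - N * (p + \<delta>)"
  proof (rule mono_except_finite[OF S, where G="\<lambda>x. u' x - N * x" and g="\<lambda>x. c \<lfloor>x\<rfloor> * u x - 1 - N"])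
    show "continuous_on {p..p + \<delta>} (\<lambda>x. u' x - N * x)"
      using p jL by (intro continuous_intros continuous_on_subset[OF D(2)]) auto
    fix t assume t0: "t \<in> {p<..<p + \<delta>} - S"
    have t: "t \<in> {0<..<real L} - S" using t0 p jL by auto
    show "((\<lambda>x. u' x - N * x) has_real_derivative c \<lfloor>t\<rfloor> * u t - 1 - N) (at t)"
      by (rule derivative_eq_intros D(4) t refl)+ simp
    have "\<lfloor>t\<rfloor> = int j" using t0 p by (intro floor_unique) auto
    then have "K \<le> c \<lfloor>t\<rfloor>" using j by simp
    moreover have "\<eta> / 2 \<le> u t" "0 \<le> u t" using large[of t] nonneg[of t] t t0 by auto
    moreover have "0 \<le> \<eta> / 2" using \<delta> by (meson mult_nonneg_nonneg of_nat_0_le_iff less_imp_le order_trans)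
    ultimately have "K * (\<eta> / 2) \<le> c \<lfloor>t\<rfloor> * u t" using K(2) by (intro mult_mono) auto
    then show "0 \<le> c \<lfloor>t\<rfloor> * u t - 1 - N" by (simp add: N_def)
  qed (use \<delta> in auto)
  then have "N * \<delta> \<le> u' (p + \<delta>) - u' p" by (simp add: algebra_simps)
  also have "\<dots> \<le> 2 * real L" using Lu[of p] Lu[of "p + \<delta>"] p \<delta> jL by (auto simp: abs_le_iff)
  finally show False using K by (simp add: N_def)
qed

text \<open>
  Around a point where \<open>u > \<eta>\<close>, the component \<open>(a, b)\<close> of the set \<open>{u > \<eta>}\<close> meets no wall,
  so it lies in a run of free cells and has length at most \<open>m\<close>. There \<open>u'' = -1\<close>, and \<open>u\<close> is
  \<open>\<eta>\<close> plus a parabola.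
\<close>

lemma landscape_le_zero_run:
  assumes ode: "cell_ode L c 1 u u'" and c: "\<And>j. j \<in> {0..<int L} \<Longrightarrow> c j \<ge> 0" and L: "L > 0"
    and u0: "u 0 = 0" "u (real L) = 0" and \<eta>: "\<eta> \<ge> 0"
    and small: "\<And>j x. j < L \<Longrightarrow> c (int j) \<noteq> 0 \<Longrightarrow> x \<in> {real j..real j + 1} \<Longrightarrow> u x < \<eta>"
    and runs: "\<And>i n. i + n \<le> L \<Longrightarrow> (\<forall>j\<in>{i..<i + n}. c (int j) = 0) \<Longrightarrow> n \<le> m"
    and x: "x \<in> {0..real L}"
  shows "u x \<le> \<eta> + (real m)\<^sup>2 / 8"
proof (cases "u x \<le> \<eta>")
  case True
  then show ?thesis by (simp add: add_increasing2)
next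
  case False
  have cu: "continuous_on {0..real L} u" using cell_odeD(1)[OF ode] .
  have cpt: "compact {y \<in> {s..t}. u y \<le> \<eta>}" if "0 \<le> s" "t \<le> real L" for s t
  proof -
    have "closed ({s..t} \<inter> u -` {..\<eta>})"
      by (intro continuous_closed_preimage continuous_on_subset[OF cu]) (use that in auto)
    moreover have "{y \<in> {s..t}. u y \<le> \<eta>} = {s..t} \<inter> ({s..t} \<inter> u -` {..\<eta>})" by auto
    ultimately show ?thesis by (metis compact_Icc compact_Int_closed)
  qed
  have "\<exists>a\<in>{y \<in> {0..x}. u y \<le> \<eta>}. \<forall>y\<in>{y \<in> {0..x}. u y \<le> \<eta>}. y \<le> a"
    by (rule compact_attains_sup) (use cpt[of 0 x] x u0 \<eta> in auto)
  then obtain a where a: "a \<in> {0..x}" "u a \<le> \<eta>" "\<And>y. y \<in> {0..x} \<Longrightarrow> u y \<le> \<eta> \<Longrightarrow> y \<le> a" by blast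
  have "\<exists>b\<in>{y \<in> {x..real L}. u y \<le> \<eta>}. \<forall>y\<in>{y \<in> {x..real L}. u y \<le> \<eta>}. b \<le> y"
    by (rule compact_attains_inf) (use cpt[of x "real L"] x u0 \<eta> in auto)
  then obtain b where b: "b \<in> {x..real L}" "u b \<le> \<eta>" "\<And>y. y \<in> {x..real L} \<Longrightarrow> u y \<le> \<eta> \<Longrightarrow> b \<le> y" by blast
  have ab: "a < x" "x < b" using a b False by (auto simp: less_le)
  have above: "u y > \<eta>" if "a < y" "y < b" for y
    using a(3)[of y] b(3)[of y] that a(1) b(1) x by force
  define i where "i = nat \<lfloor>a\<rfloor>"
  define l where "l = nat \<lceil>b\<rceil>"
  have i: "real i \<le> a" "a < real i + 1" using a(1) by (auto simp: i_def)
  have l: "b \<le> real l" "real l < b + 1" "l \<le> L"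
  proof -
    have b0: "0 \<le> b" using ab a by auto
    then have "real l = of_int \<lceil>b\<rceil>" by (simp add: l_def)
    then show "b \<le> real l" "real l < b + 1" by linarith+
    then have "real l < real L + 1" using b(1) by auto
    then show "l \<le> L" by linarith
  qed
  have il: "i \<le> l" using i l ab by linarith
  have zero: "c (int j) = 0" if j: "j \<in> {i..<l}" for j
  proof (rule ccontr)
    assume nz: "c (int j) \<noteq> 0"
    \<comment> \<open>A point of the wall that lies inside \<open>(a, b)\<close>.\<close>
    define y where "y = (max a (real j) + min b (real j + 1)) / 2"
    have "j < l" "i \<le> j" using j by auto
    then have "real j \<le> real l - 1" "real i \<le> real j" by linarith+
    then have "real j < b" "a < real j + 1" using i l by linarith+
    then have "max a (real j) < min b (real j + 1)" using ab by auto
    then have y: "a < y" "y < b" "y \<in> {real j..real j + 1}" unfolding y_def by auto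
    have "u y < \<eta>" by (rule small[OF _ nz y(3)]) (use j l in auto)
    then show False using above[OF y(1,2)] by simp
  qed
  have "l - i \<le> m" by (rule runs[of i]) (use zero il l in auto)
  then have "real l - real i \<le> real m" using il by linarith
  then have bam: "b - a \<le> real m" using i l by linarith
  have "u x \<le> \<eta> + 1 / 2 * ((x - a) * (b - x))"
  proof (rule landscape_le_parabola[OF ode c])
    fix t assume t: "t \<in> {a<..<b}"
    have "real_of_int (int i) \<le> t" "t < real_of_int (int l)" using i l t by auto
    then have "int i \<le> \<lfloor>t\<rfloor>" "\<lfloor>t\<rfloor> < int l" by (simp_all only: le_floor_iff floor_less_iff)
    then have "c (int (nat \<lfloor>t\<rfloor>)) = 0" by (intro zero) auto
    moreover have "int (nat \<lfloor>t\<rfloor>) = \<lfloor>t\<rfloor>" using t a by auto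
    ultimately have "c \<lfloor>t\<rfloor> = 0" by simp
    then show "1 \<le> 2 * (1 / 2) + c \<lfloor>t\<rfloor> * (\<eta> + 1 / 2 * ((t - a) * (b - t)))" by simp
  qed (use a(1,2) b(1,2) ab in auto)
  also have "\<dots> \<le> \<eta> + (b - a)\<^sup>2 / 8" using parabola_le[of x a b] by linarith
  also have "(b - a)\<^sup>2 \<le> (real m)\<^sup>2" using bam ab by (intro power_mono) auto
  finally show ?thesis by simp
qed

text \<open>
  The length of the run of zeros that ends just before position \<open>j\<close>.
\<close>

fun zeros_before :: "(nat \<Rightarrow> real) \<Rightarrow> nat \<Rightarrow> nat" where
  "zeros_before c 0 = 0"
| "zeros_before c (Suc j) = (if c j = 0 then Suc (zeros_before c j) else 0)"

lemma zeros_before_run: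
  "zeros_before c j \<le> j \<and> (\<forall>i\<in>{j - zeros_before c j..<j}. c i = 0)"
proof (induction j)
  case (Suc j)
  show ?case
  proof (cases "c j = 0")
    case True
    have "c i = 0" if "i \<in> {j - zeros_before c j..<Suc j}" for i
      using Suc that True less_Suc_eq[of i j] by (metis atLeastLessThan_iff)
    then show ?thesis using Suc True by simp
  qed simp
qed simp

text \<open>
  On a free run that starts at \<open>a\<close> the subsolution is \<open>- \<alpha> tan (\<alpha> (x - a - m / 2))\<close>, the
  logarithmic derivative of a cosine. It is finite because the run has length at most \<open>m\<close> and
  \<open>\<alpha> m < \<pi>\<close>; it starts at \<open>T\<close> and never falls below \<open>- T\<close>. On a wall a linear function rises from
  \<open>- T\<close> to \<open>T\<close>, which the height of the wall allows. Thus all jumps go downwards.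
\<close>

lemma eigenvalue_ge_zero_runs:
  fixes c :: "int \<Rightarrow> real" and L m :: nat and \<alpha> K :: real
  assumes eig: "dirichlet_eigenvalue (real L) (\<lambda>x. c \<lfloor>x\<rfloor>) \<mu>" and L: "L > 0"
    and runs: "\<And>i n. i + n \<le> L \<Longrightarrow> (\<forall>j\<in>{i..<i + n}. c (int j) = 0) \<Longrightarrow> n \<le> m"
    and \<alpha>: "\<alpha> > 0" "\<alpha> * real m < pi"
  defines "T \<equiv> \<alpha> * tan (\<alpha> * real m / 2)"
  assumes high: "\<And>j. j < L \<Longrightarrow> c (int j) \<noteq> 0 \<Longrightarrow> c (int j) \<ge> 2 * T + T\<^sup>2 + \<alpha>\<^sup>2"
  shows "\<alpha>\<^sup>2 \<le> \<mu>"
proof -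
  define d where "d = zeros_before (\<lambda>j. c (int j))"
  have d_le: "d j \<le> m" if j: "j \<le> L" for j
  proof -
    have dj: "d j \<le> j" and z: "\<forall>i\<in>{j - d j..<j}. c (int i) = 0"
      unfolding d_def using zeros_before_run[of "\<lambda>j. c (int j)" j] by blast+
    have "j - d j + d j = j" using dj by (rule le_add_diff_inverse2)
    then show ?thesis using runs[of "j - d j" "d j"] z j by (simp only:)
  qed
  have angle: "0 \<le> \<alpha> * real m / 2" "\<alpha> * real m / 2 < pi / 2" using \<alpha> by auto
  have T: "T \<ge> 0" unfolding T_def using angle \<alpha>(1) by (intro mult_nonneg_nonneg tan_pos_pi2_le) auto
  have tan_bound: "- T \<le> \<alpha> * tan (\<alpha> * y)" "\<alpha> * tan (\<alpha> * y) \<le> T" "cos (\<alpha> * y) \<noteq> 0"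
    if y: "- (real m / 2) \<le> y" "y \<le> real m / 2" for y
  proof -
    have y': "- (\<alpha> * real m / 2) \<le> \<alpha> * y" "\<alpha> * y \<le> \<alpha> * real m / 2"
      using mult_left_mono[OF y(1), of \<alpha>] mult_left_mono[OF y(2), of \<alpha>] \<alpha>(1) by auto
    have "tan (\<alpha> * y) \<le> tan (\<alpha> * real m / 2)"
      by (rule tan_mono_le) (use y' angle in linarith)+
    moreover have "tan (- (\<alpha> * real m / 2)) \<le> tan (\<alpha> * y)"
      by (rule tan_mono_le) (use y' angle in linarith)+
    ultimately have "\<alpha> * tan (\<alpha> * y) \<le> T" "\<alpha> * (- tan (\<alpha> * real m / 2)) \<le> \<alpha> * tan (\<alpha> * y)"
      unfolding T_def using \<alpha>(1) by (intro mult_left_mono; simp)+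
    then show "\<alpha> * tan (\<alpha> * y) \<le> T" "- T \<le> \<alpha> * tan (\<alpha> * y)" by (auto simp: T_def)
    have "cos (\<alpha> * y) > 0" using y' angle by (intro cos_gt_zero_pi) auto
    then show "cos (\<alpha> * y) \<noteq> 0" by simp
  qed
  \<comment> \<open>The signed distance of \<open>x\<close> from the point \<open>a + m / 2\<close>, for a run that starts at \<open>a = j - d j\<close>;
    its formula does not change from one cell of a run to the next.\<close>
  define y where "y j x = x - (real j - real (d j)) - real m / 2" for j x
  define \<rho> where "\<rho> j x = (if c (int j) = 0 then - (\<alpha> * tan (\<alpha> * y j x)) else 2 * T * (x - real j - 1 / 2))" for j x
  define \<rho>' where "\<rho>' j x = (if c (int j) = 0 then - (\<alpha>\<^sup>2 * (1 + (tan (\<alpha> * y j x))\<^sup>2)) else 2 * T)" for j x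
  have y_range: "- (real m / 2) \<le> y j x" "y j x \<le> real m / 2"
    if "j < L" "c (int j) = 0" "x \<in> {real j..real j + 1}" for j x
  proof -
    have "d (Suc j) \<le> m" using that d_le by auto
    then have "real (d j) + 1 \<le> real m" using that(2) by (simp add: d_def)
    then show "- (real m / 2) \<le> y j x" "y j x \<le> real m / 2" using that(3) by (auto simp: y_def)
  qed
  show ?thesis
  proof (rule eigenvalue_ge_if_riccati_subsolution[OF eig L])
    fix j x assume j: "j < L" and x: "x \<in> {real j..real j + 1}"
    show "(\<rho> j has_real_derivative \<rho>' j x) (at x)"
    proof (cases "c (int j) = 0")
      case True
      note cz = tan_bound(3)[OF y_range[OF j True x]]
      have "((\<lambda>x. - (\<alpha> * tan (\<alpha> * y j x))) has_real_derivative - (\<alpha> * (\<alpha> * inverse ((cos (\<alpha> * y j x))\<^sup>2)))) (at x)"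
        using cz unfolding y_def by (auto intro!: derivative_eq_intros)
      moreover have "inverse ((cos (\<alpha> * y j x))\<^sup>2) = 1 + (tan (\<alpha> * y j x))\<^sup>2"
        using tan_sec[OF cz] by (simp add: power_inverse)
      moreover have "\<rho> j = (\<lambda>x. - (\<alpha> * tan (\<alpha> * y j x)))" using True by (auto simp: \<rho>_def)
      ultimately show ?thesis using True by (simp add: \<rho>'_def power2_eq_square mult.assoc)
    next
      case False
      have "\<rho> j = (\<lambda>x. 2 * T * (x - real j - 1 / 2))" using False by (auto simp: \<rho>_def)
      then show ?thesis using False by (auto simp: \<rho>'_def intro!: derivative_eq_intros)
    qed
    show "\<rho>' j x + (\<rho> j x)\<^sup>2 \<le> c (int j) - \<alpha>\<^sup>2"
    proof (cases "c (int j) = 0")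
      case True
      then show ?thesis by (simp add: \<rho>_def \<rho>'_def algebra_simps power_mult_distrib)
    next
      case False
      have "\<bar>2 * (x - real j - 1 / 2)\<bar> \<le> 1" using x by (auto simp: abs_le_iff)
      then have "(2 * (x - real j - 1 / 2))\<^sup>2 \<le> 1" by (simp add: abs_square_le_1)
      then have "T\<^sup>2 * (2 * (x - real j - 1 / 2))\<^sup>2 \<le> T\<^sup>2" by (simp add: mult_left_le)
      moreover have "\<rho> j x = T * (2 * (x - real j - 1 / 2))" "\<rho>' j x = 2 * T"
        using False by (simp_all add: \<rho>_def \<rho>'_def)
      ultimately show ?thesis using high[OF j False] by (simp add: power_mult_distrib)
    qed
  next
    fix j assume j: "Suc j < L"
    have end_ge: "- T \<le> \<rho> j (real (Suc j))"
    proof (cases "c (int j) = 0")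
      case True
      then show ?thesis using tan_bound(2)[OF y_range[of j "real (Suc j)"]] j by (simp add: \<rho>_def)
    next
      case False
      then show ?thesis using T by (simp add: \<rho>_def)
    qed
    have start_le: "\<rho> (Suc j) (real (Suc j)) \<le> T"
    proof (cases "c (int (Suc j)) = 0")
      case True
      then show ?thesis using tan_bound(1)[OF y_range[of "Suc j" "real (Suc j)"]] j by (simp add: \<rho>_def)
    next
      case False
      then show ?thesis using T by (simp add: \<rho>_def)
    qed
    show "\<rho> (Suc j) (real (Suc j)) \<le> \<rho> j (real (Suc j))"
    proof (cases "c (int (Suc j)) = 0")
      case False
      then have "\<rho> (Suc j) (real (Suc j)) = - T" by (simp add: \<rho>_def)
      then show ?thesis using end_ge by simp
    next
      case z: True
      show ?thesis
      proof (cases "c (int j) = 0")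
        case True
        then have "y (Suc j) (real (Suc j)) = y j (real (Suc j))" by (simp add: y_def d_def)
        then show ?thesis using True z by (simp add: \<rho>_def)
      next
        case False
        then have "\<rho> j (real (Suc j)) = T" by (simp add: \<rho>_def)
        then show ?thesis using start_le by simp
      qed
    qed
  qed
qed

section \<open>The strong-disorder limit of the landscape ratio\<close>

lemma potential_eq: "potential v x = v \<lfloor>x\<rfloor>"
proof -
  have "indicator {0..<1} (x - of_int j) = (if j = \<lfloor>x\<rfloor> then 1 else 0 :: real)" for j
  proof (cases "j = \<lfloor>x\<rfloor>")
    case True
    then show ?thesis using floor_correct[of x] by (simp add: indicator_def) linarith
  next
    case False
    then have "x - of_int j \<notin> {0..<1}" using floor_unique[of j x] by auto
    then show ?thesis using False by simp
  qed
  then have "potential v x = (\<Sum>\<^sub>\<infinity>j. v j * (if j = \<lfloor>x\<rfloor> then 1 else 0))"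
    unfolding potential_def by simp
  also have "\<dots> = (\<Sum>\<^sub>\<infinity>j\<in>{\<lfloor>x\<rfloor>}. v j * (if j = \<lfloor>x\<rfloor> then 1 else 0))"
    by (rule infsum_cong_neutral) auto
  also have "\<dots> = v \<lfloor>x\<rfloor>" by simp
  finally show ?thesis .
qed

definition cell_ratio :: "nat \<Rightarrow> (int \<Rightarrow> real) \<Rightarrow> real" where
  "cell_ratio L c = ground_state_energy (real L) (\<lambda>x. c \<lfloor>x\<rfloor>) / min_inverse_landscape (real L) (\<lambda>x. c \<lfloor>x\<rfloor>)"

lemma landscape_ratio_eq: "landscape_ratio (real L) k v = cell_ratio L (\<lambda>j. k * v j)"
  by (simp add: landscape_ratio_def cell_ratio_def potential_eq)

text \<open>
  Energy and landscape are tested on a cell \<open>j0\<close> where the potential is smallest; the opposite bounds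
  come from the constants \<open>\<rho> = 0\<close> and \<open>1 / \<kappa>\<close>.
\<close>

lemma cell_ratio_bounds_positive:
  fixes c :: "int \<Rightarrow> real"
  assumes \<kappa>: "\<kappa> > 0" "\<And>j. j \<in> {0..<int L} \<Longrightarrow> c j \<ge> \<kappa>" and j0: "j0 < L" "c (int j0) = \<kappa>"
  shows "\<kappa> / (\<kappa> + 8) \<le> cell_ratio L c" "cell_ratio L c \<le> (\<kappa> + pi\<^sup>2) / \<kappa>"
proof -
  define E where "E = ground_state_energy (real L) (\<lambda>x. c \<lfloor>x\<rfloor>)"
  have c: "c j \<ge> 0" if "j \<in> {0..<int L}" for j using \<kappa> that by force
  have run: "c j = \<kappa>" if "j \<in> {int j0..<int (j0 + 1)}" for j
    using that j0 by (cases "j = int j0") auto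
  have L: "L > 0" and j0L: "j0 + 1 \<le> L" using j0 by auto
  have E: "dirichlet_eigenvalue (real L) (\<lambda>x. c \<lfloor>x\<rfloor>) E" "E \<le> \<kappa> + pi\<^sup>2"
    using ground_state_energy_properties[of L c 1 j0 \<kappa>] c run j0L unfolding E_def by auto
  have "\<kappa> \<le> E"
    by (rule eigenvalue_ge_if_riccati_subsolution[OF E(1) L, where \<rho>="\<lambda>_ _. 0" and \<rho>'="\<lambda>_ _. 0"])
      (use \<kappa> in auto)
  have "\<exists>u u' x0. cell_ode L c 1 u u' \<and> u 0 = 0 \<and> u (real L) = 0 \<and>
      (\<forall>x\<in>{0..real L}. 0 \<le> u x \<and> u x \<le> u x0) \<and> x0 \<in> {0<..<real L} \<and>
      min_inverse_landscape (real L) (\<lambda>x. c \<lfloor>x\<rfloor>) = 1 / u x0"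
    by (rule min_inverse_landscape_properties) (use c L in auto)
  then obtain u u' x0 where ode: "cell_ode L c 1 u u'" and u0: "u 0 = 0" "u (real L) = 0"
    and u: "\<And>x. x \<in> {0..real L} \<Longrightarrow> 0 \<le> u x" "\<And>x. x \<in> {0..real L} \<Longrightarrow> u x \<le> u x0" and x0: "x0 \<in> {0<..<real L}"
    and minv: "min_inverse_landscape (real L) (\<lambda>x. c \<lfloor>x\<rfloor>) = 1 / u x0" by blast
  have ratio: "cell_ratio L c = E * u x0" by (simp add: cell_ratio_def minv E_def)
  have "1 / (\<kappa> + 8 / (real 1)\<^sup>2) \<le> u (real j0 + real 1 / 2)"
    by (rule landscape_max_ge_run[OF ode c u(1)]) (use run j0L in auto)
  also have "\<dots> \<le> u x0" by (rule u(2)) (use j0L in auto)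
  finally have lower: "1 / (\<kappa> + 8) \<le> u x0" by simp
  have upper: "u x0 \<le> 1 / \<kappa>"
    by (rule landscape_le_inverse_potential[OF ode \<kappa> u0]) (use x0 in auto)
  have "\<kappa> * (1 / (\<kappa> + 8)) \<le> E * u x0"
    using lower \<open>\<kappa> \<le> E\<close> \<kappa>(1) by (intro mult_mono) auto
  then show "\<kappa> / (\<kappa> + 8) \<le> cell_ratio L c" by (simp add: ratio)
  have "E * u x0 \<le> (\<kappa> + pi\<^sup>2) * (1 / \<kappa>)"
    using upper E(2) \<kappa>(1) u(1)[of x0] x0 by (intro mult_mono) auto
  then show "cell_ratio L c \<le> (\<kappa> + pi\<^sup>2) / \<kappa>" by (simp add: ratio)
qed

text \<open>
  The two bounds require different heights \<open>K\<close> of the walls, so each has its own hypotheses. As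
  \<open>\<alpha>\<close> tends to \<open>\<pi> / m\<close> and \<open>\<eta>\<close> to \<open>0\<close>, both tend to \<open>\<pi>\<^sup>2 / 8\<close>.
\<close>

lemma cell_ratio_bounds_zero_runs:
  fixes c :: "int \<Rightarrow> real" and L m i :: nat and \<alpha> \<delta> \<eta> K :: real
  assumes c: "\<And>j. j \<in> {0..<int L} \<Longrightarrow> c j \<ge> 0" and m: "m > 0" "i + m \<le> L"
    and run: "\<forall>j\<in>{i..<i + m}. c (int j) = 0"
    and runs: "\<And>i n. i + n \<le> L \<Longrightarrow> (\<forall>j\<in>{i..<i + n}. c (int j) = 0) \<Longrightarrow> n \<le> m"
    and high: "\<And>j. j < L \<Longrightarrow> c (int j) \<noteq> 0 \<Longrightarrow> c (int j) \<ge> K" and K: "K \<ge> 0"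
  shows "\<alpha> > 0 \<Longrightarrow> \<alpha> * real m < pi \<Longrightarrow>
      K \<ge> 2 * (\<alpha> * tan (\<alpha> * real m / 2)) + (\<alpha> * tan (\<alpha> * real m / 2))\<^sup>2 + \<alpha>\<^sup>2 \<Longrightarrow>
      \<alpha>\<^sup>2 * ((real m)\<^sup>2 / 8) \<le> cell_ratio L c"
    and "0 < \<delta> \<Longrightarrow> \<delta> \<le> 1 / 2 \<Longrightarrow> real L * \<delta> \<le> \<eta> / 2 \<Longrightarrow> (K * \<eta> / 2 - 1) * \<delta> > 2 * real L \<Longrightarrow>
      cell_ratio L c \<le> (pi / real m)\<^sup>2 * (\<eta> + (real m)\<^sup>2 / 8)"
proof -
  define E where "E = ground_state_energy (real L) (\<lambda>x. c \<lfloor>x\<rfloor>)"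
  have L: "L > 0" using m by simp
  have run0: "c j = 0" if "j \<in> {int i..<int (i + m)}" for j
  proof -
    have "nat j \<in> {i..<i + m}" using that by auto
    then have "c (int (nat j)) = 0" using run by blast
    moreover have "int (nat j) = j" using that by simp
    ultimately show ?thesis by simp
  qed
  have E: "dirichlet_eigenvalue (real L) (\<lambda>x. c \<lfloor>x\<rfloor>) E" "E \<le> (pi / real m)\<^sup>2"
    using ground_state_energy_properties[of L c m i 0] c run0 m unfolding E_def by auto
  have "\<exists>u u' x0. cell_ode L c 1 u u' \<and> u 0 = 0 \<and> u (real L) = 0 \<and>
      (\<forall>x\<in>{0..real L}. 0 \<le> u x \<and> u x \<le> u x0) \<and> x0 \<in> {0<..<real L} \<and>
      min_inverse_landscape (real L) (\<lambda>x. c \<lfloor>x\<rfloor>) = 1 / u x0"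
    by (rule min_inverse_landscape_properties) (use c L in auto)
  then obtain u u' x0 where ode: "cell_ode L c 1 u u'" and u0: "u 0 = 0" "u (real L) = 0"
    and u: "\<And>x. x \<in> {0..real L} \<Longrightarrow> 0 \<le> u x" "\<And>x. x \<in> {0..real L} \<Longrightarrow> u x \<le> u x0" and x0: "x0 \<in> {0<..<real L}"
    and minv: "min_inverse_landscape (real L) (\<lambda>x. c \<lfloor>x\<rfloor>) = 1 / u x0" by blast
  have ratio: "cell_ratio L c = E * u x0" by (simp add: cell_ratio_def minv E_def)
  have "1 / (0 + 8 / (real m)\<^sup>2) \<le> u (real i + real m / 2)"
    by (rule landscape_max_ge_run[OF ode c u(1) m run0])
  also have "\<dots> \<le> u x0" by (rule u(2)) (use m in auto)
  finally have lower: "(real m)\<^sup>2 / 8 \<le> u x0" by simp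
  show "\<alpha>\<^sup>2 * ((real m)\<^sup>2 / 8) \<le> cell_ratio L c"
    if \<alpha>: "\<alpha> > 0" "\<alpha> * real m < pi"
      and KT: "K \<ge> 2 * (\<alpha> * tan (\<alpha> * real m / 2)) + (\<alpha> * tan (\<alpha> * real m / 2))\<^sup>2 + \<alpha>\<^sup>2"
  proof -
    have "\<alpha>\<^sup>2 \<le> E"
    proof (rule eigenvalue_ge_zero_runs[OF E(1) L _ \<alpha>])
      fix j assume "j < L" "c (int j) \<noteq> 0"
      then have "K \<le> c (int j)" by (rule high)
      then show "2 * (\<alpha> * tan (\<alpha> * real m / 2)) + (\<alpha> * tan (\<alpha> * real m / 2))\<^sup>2 + \<alpha>\<^sup>2 \<le> c (int j)"
        using KT by linarith
    qed (rule runs)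
    then show ?thesis unfolding ratio using lower by (intro mult_mono order_trans[OF _ \<open>\<alpha>\<^sup>2 \<le> E\<close>]) auto
  qed
  show "cell_ratio L c \<le> (pi / real m)\<^sup>2 * (\<eta> + (real m)\<^sup>2 / 8)"
    if \<delta>: "0 < \<delta>" "\<delta> \<le> 1 / 2" "real L * \<delta> \<le> \<eta> / 2" and K\<delta>: "(K * \<eta> / 2 - 1) * \<delta> > 2 * real L"
  proof -
    have "0 < real L * \<delta>" using L \<delta> by simp
    then have \<eta>: "0 \<le> \<eta>" using \<delta>(3) by linarith
    have small: "u x < \<eta>" if "j < L" "c (int j) \<noteq> 0" "x \<in> {real j..real j + 1}" for j x
      by (rule landscape_small_on_high_cell[OF ode c L u(1) u0 that(1) high[OF that(1,2)] that(3) \<delta> K\<delta> K])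
    have "u x0 \<le> \<eta> + (real m)\<^sup>2 / 8"
      by (rule landscape_le_zero_run[OF ode c L u0 \<eta> small runs]) (use x0 in auto)
    then show ?thesis unfolding ratio using E(2) u(1)[of x0] x0 by (intro mult_mono) auto
  qed
qed

lemma landscape_ratio_tendsto_positive:
  assumes L: "L > 0" and v: "\<And>j. j < L \<Longrightarrow> v (int j) > 0"
  shows "((\<lambda>k. landscape_ratio (real L) k v) \<longlongrightarrow> 1) at_top"
proof -
  obtain j0 where j0: "j0 < L" "\<And>j. j < L \<Longrightarrow> v (int j0) \<le> v (int j)"
  proof -
    define V where "V = (\<lambda>j. v (int j)) ` {..<L}"
    have V: "finite V" "V \<noteq> {}" using L by (auto simp: V_def)
    obtain j0 where "j0 < L" "Min V = v (int j0)" using Min_in[OF V] unfolding V_def by blast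
    moreover have "Min V \<le> v (int j)" if "j < L" for j
      by (rule Min_le[OF V(1)]) (use that in \<open>simp add: V_def\<close>)
    ultimately show ?thesis using that[of j0] by simp
  qed
  define w where "w = v (int j0)"
  have w: "w > 0" using v j0 by (simp add: w_def)
  have bounds: "k * w / (k * w + 8) \<le> landscape_ratio (real L) k v"
    "landscape_ratio (real L) k v \<le> (k * w + pi\<^sup>2) / (k * w)" if "k > 0" for k
  proof -
    have "k * w \<le> k * v j" if "j \<in> {0..<int L}" for j
      using j0(2)[of "nat j"] that \<open>k > 0\<close> by (auto simp: w_def)
    note kv = this
    have kw: "k * w > 0" "k * v (int j0) = k * w" using that w by (simp_all add: w_def)
    show "k * w / (k * w + 8) \<le> landscape_ratio (real L) k v"
      unfolding landscape_ratio_eq by (rule cell_ratio_bounds_positive(1)) (fact kv kw j0(1))+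
    show "landscape_ratio (real L) k v \<le> (k * w + pi\<^sup>2) / (k * w)"
      unfolding landscape_ratio_eq by (rule cell_ratio_bounds_positive(2)) (fact kv kw j0(1))+
  qed
  have inf: "filterlim (\<lambda>k. k * w) at_infinity at_top"
    by (rule filterlim_at_top_imp_at_infinity[OF filterlim_at_top_mult_tendsto_pos[OF tendsto_const w filterlim_ident]])
  have z: "((\<lambda>k. a / (k * w)) \<longlongrightarrow> 0) at_top" for a
    by (rule tendsto_divide_0[OF tendsto_const inf])
  show ?thesis
  proof (rule tendsto_sandwich)
    have "((\<lambda>k. 1 / (1 + 8 / (k * w))) \<longlongrightarrow> 1 / (1 + 0)) at_top"
      by (intro tendsto_intros z) auto
    moreover have "eventually (\<lambda>k. 1 / (1 + 8 / (k * w)) = k * w / (k * w + 8)) at_top"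
      using eventually_gt_at_top[of 0] by eventually_elim (use w in \<open>auto simp: field_simps\<close>)
    ultimately show "((\<lambda>k. k * w / (k * w + 8)) \<longlongrightarrow> 1) at_top"
      by (simp add: tendsto_cong)
    have "((\<lambda>k. 1 + pi\<^sup>2 / (k * w)) \<longlongrightarrow> 1 + 0) at_top"
      by (intro tendsto_intros z)
    moreover have "eventually (\<lambda>k. 1 + pi\<^sup>2 / (k * w) = (k * w + pi\<^sup>2) / (k * w)) at_top"
      using eventually_gt_at_top[of 0] by eventually_elim (use w in \<open>auto simp: field_simps\<close>)
    ultimately show "((\<lambda>k. (k * w + pi\<^sup>2) / (k * w)) \<longlongrightarrow> 1) at_top"
      by (simp add: tendsto_cong)
    show "\<forall>\<^sub>F k in at_top. k * w / (k * w + 8) \<le> landscape_ratio (real L) k v"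
      "\<forall>\<^sub>F k in at_top. landscape_ratio (real L) k v \<le> (k * w + pi\<^sup>2) / (k * w)"
      by (rule eventually_mono[OF eventually_gt_at_top[of 0]], rule bounds, assumption)+
  qed
qed

lemma landscape_ratio_tendsto_zero_run:
  assumes v: "\<And>j. j < L \<Longrightarrow> v (int j) \<ge> 0" and ex: "\<exists>j<L. v (int j) = 0"
  shows "((\<lambda>k. landscape_ratio (real L) k v) \<longlongrightarrow> pi\<^sup>2 / 8) at_top"
proof -
  define R where "R = {n. \<exists>i. i + n \<le> L \<and> (\<forall>j\<in>{i..<i + n}. v (int j) = 0)}"
  define m where "m = Max R"
  have finR: "finite R" by (rule finite_subset[of _ "{..L}"]) (auto simp: R_def)
  have "1 \<in> R"
  proof -
    obtain j where "j < L" "v (int j) = 0" using ex by blast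
    then show ?thesis unfolding R_def by (intro CollectI exI[of _ j]) (auto simp: less_Suc_eq_le)
  qed
  then have m1: "m \<in> R" "m \<ge> 1" unfolding m_def using finR by (auto intro: Max_in)
  have runs: "n \<le> m" if "i + n \<le> L" "\<forall>j\<in>{i..<i + n}. v (int j) = 0" for i n
    unfolding m_def by (rule Max_ge[OF finR]) (use that in \<open>auto simp: R_def\<close>)
  obtain i where i: "i + m \<le> L" "\<forall>j\<in>{i..<i + m}. v (int j) = 0" using m1(1) unfolding R_def by blast
  have m: "m > 0" "real m > 0" using m1(2) by auto
  have L: "L > 0" using ex by auto
  \<comment> \<open>The element \<open>1\<close> keeps the set nonempty when every cell is free.\<close>
  define V where "V = insert 1 {v (int j) |j. j < L \<and> v (int j) \<noteq> 0}"
  define w where "w = Min V"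
  have finV: "finite V" unfolding V_def by simp
  have "w \<in> V" unfolding w_def by (rule Min_in[OF finV]) (simp add: V_def)
  then have w: "w > 0" using v by (force simp: V_def less_le)
  have wv: "w \<le> v (int j)" if "j < L" "v (int j) \<noteq> 0" for j
    unfolding w_def by (rule Min_le[OF finV]) (use that in \<open>auto simp: V_def\<close>)
  have cell: "\<And>j. j \<in> {0..<int L} \<Longrightarrow> k * v j \<ge> 0" "\<forall>j\<in>{i..<i + m}. k * v (int j) = 0"
    "\<And>i n. i + n \<le> L \<Longrightarrow> (\<forall>j\<in>{i..<i + n}. k * v (int j) = 0) \<Longrightarrow> n \<le> m"
    "\<And>j. j < L \<Longrightarrow> k * v (int j) \<noteq> 0 \<Longrightarrow> k * v (int j) \<ge> k * w" "k * w \<ge> 0" if k: "k > 0" for k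
  proof -
    show "k * v j \<ge> 0" if "j \<in> {0..<int L}" for j
      using v[of "nat j"] that k by auto
    show "n \<le> m" if "i + n \<le> L" "\<forall>j\<in>{i..<i + n}. k * v (int j) = 0" for i n
      by (rule runs[OF that(1)]) (use that(2) k in auto)
    show "k * v (int j) \<ge> k * w" if "j < L" "k * v (int j) \<noteq> 0" for j
      using wv[of j] that k by auto
  qed (use i k w in auto)
  show ?thesis
  proof (rule order_tendstoI)
    fix l :: real assume l: "l < pi\<^sup>2 / 8"
    have lim: "((\<lambda>\<alpha>. \<alpha>\<^sup>2 * ((real m)\<^sup>2 / 8)) \<longlongrightarrow> (pi / real m)\<^sup>2 * ((real m)\<^sup>2 / 8)) (at_left (pi / real m))"
      by (intro tendsto_intros)
    have "l < (pi / real m)\<^sup>2 * ((real m)\<^sup>2 / 8)" using l m by (simp add: power_divide)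
    then have "\<forall>\<^sub>F \<alpha> in at_left (pi / real m). l < \<alpha>\<^sup>2 * ((real m)\<^sup>2 / 8)"
      by (rule order_tendstoD(1)[OF lim])
    moreover have "\<forall>\<^sub>F \<alpha> in at_left (pi / real m). \<alpha> \<in> {0<..<pi / real m}"
      by (rule eventually_at_left_real) (use m in simp)
    ultimately have "\<forall>\<^sub>F \<alpha> in at_left (pi / real m). l < \<alpha>\<^sup>2 * ((real m)\<^sup>2 / 8) \<and> \<alpha> \<in> {0<..<pi / real m}"
      by (rule eventually_conj)
    then obtain \<alpha> where \<alpha>: "l < \<alpha>\<^sup>2 * ((real m)\<^sup>2 / 8)" "0 < \<alpha>" "\<alpha> < pi / real m"
      using eventually_happens[of _ "at_left (pi / real m)"] by (auto simp: trivial_limit_at_left_real)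
    have \<alpha>m: "\<alpha> * real m < pi" using \<alpha>(3) m by (simp add: field_simps)
    define T where "T = \<alpha> * tan (\<alpha> * real m / 2)"
    show "\<forall>\<^sub>F k in at_top. l < landscape_ratio (real L) k v"
      using eventually_gt_at_top[of 0] eventually_gt_at_top[of "(2 * T + T\<^sup>2 + \<alpha>\<^sup>2) / w"]
    proof eventually_elim
      case (elim k)
      have "2 * T + T\<^sup>2 + \<alpha>\<^sup>2 \<le> k * w" using elim(2) w by (simp add: pos_divide_less_eq)
      note high = this[unfolded T_def]
      have "\<alpha>\<^sup>2 * ((real m)\<^sup>2 / 8) \<le> cell_ratio L (\<lambda>j. k * v j)"
        by (rule cell_ratio_bounds_zero_runs(1)[where i=i and K="k * w"])
          (fact cell[OF elim(1)] m(1) i(1) \<alpha>(2) \<alpha>m high)+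
      then show ?case using \<alpha>(1) by (simp add: landscape_ratio_eq)
    qed
  next
    fix h :: real assume h: "pi\<^sup>2 / 8 < h"
    \<comment> \<open>This choice leaves half of the gap between \<open>\<pi>\<^sup>2 / 8\<close> and \<open>h\<close>.\<close>
    define \<eta> where "\<eta> = (h - pi\<^sup>2 / 8) / 2 * (real m / pi)\<^sup>2"
    have \<eta>: "\<eta> > 0" using h m by (simp add: \<eta>_def)
    have "(pi / real m)\<^sup>2 * (\<eta> + (real m)\<^sup>2 / 8) = (pi / real m * (real m / pi))\<^sup>2 * ((h - pi\<^sup>2 / 8) / 2) + (pi / real m * real m)\<^sup>2 / 8"
      unfolding \<eta>_def power_mult_distrib by (simp only: algebra_simps) simp
    also have "\<dots> = (h - pi\<^sup>2 / 8) / 2 + pi\<^sup>2 / 8" using m by simp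
    also have "\<dots> < h" using h by (simp add: field_simps)
    finally have \<eta>h: "(pi / real m)\<^sup>2 * (\<eta> + (real m)\<^sup>2 / 8) < h" .
    define \<delta> where "\<delta> = min (1 / 2) (\<eta> / (2 * real L))"
    have \<delta>: "0 < \<delta>" "\<delta> \<le> 1 / 2" using \<eta> L by (auto simp: \<delta>_def)
    have "\<delta> \<le> \<eta> / (2 * real L)" by (simp add: \<delta>_def)
    then have \<delta>L: "real L * \<delta> \<le> \<eta> / 2" using L by (simp add: field_simps)
    show "\<forall>\<^sub>F k in at_top. landscape_ratio (real L) k v < h"
      using eventually_gt_at_top[of 0] eventually_gt_at_top[of "(2 * real L / \<delta> + 1) * 2 / \<eta> / w"]
    proof eventually_elim
      case (elim k)
      have "(2 * real L / \<delta> + 1) * 2 / \<eta> < k * w" using elim(2) w by (simp only: pos_divide_less_eq)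
      then have "(2 * real L / \<delta> + 1) * 2 < k * w * \<eta>" using \<eta> by (simp only: pos_divide_less_eq)
      then have "2 * real L / \<delta> < k * w * \<eta> / 2 - 1" by simp
      then have high: "2 * real L < (k * w * \<eta> / 2 - 1) * \<delta>" using \<delta>(1) by (simp only: pos_divide_less_eq)
      have "cell_ratio L (\<lambda>j. k * v j) \<le> (pi / real m)\<^sup>2 * (\<eta> + (real m)\<^sup>2 / 8)"
        by (rule cell_ratio_bounds_zero_runs(2)[where i=i and K="k * w" and \<delta>=\<delta>])
          (fact cell[OF elim(1)] m(1) i(1) \<delta> \<delta>L high)+
      then show ?case using \<eta>h by (simp add: landscape_ratio_eq)
    qed
  qed
qed

section \<open>The random potential\<close>

lemma (in prob_space) prob_all_nonzero:
  fixes X :: "int \<Rightarrow> 'a \<Rightarrow> real"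
  assumes indep: "indep_vars (\<lambda>_. borel) X UNIV" and Y: "Y \<in> borel_measurable M"
    and distr: "\<And>j. distr M borel (X j) = distr M borel Y" and L: "L > 0"
  shows "prob {s \<in> space M. \<forall>j<L. X (int j) s \<noteq> 0} = (1 - prob {s \<in> space M. Y s = 0}) ^ L"
proof -
  have X: "X j \<in> borel_measurable M" for j
    using indep by (auto simp: indep_vars_def)
  have single: "prob (X j -` (- {0}) \<inter> space M) = 1 - prob {s \<in> space M. Y s = 0}" for j
  proof -
    have "prob (X j -` (- {0}) \<inter> space M) = measure (distr M borel (X j)) (- {0})"
      by (rule measure_distr[symmetric]) (use X in auto)
    also have "\<dots> = prob (Y -` (- {0}) \<inter> space M)"
      unfolding distr by (rule measure_distr) (use Y in auto)
    also have "Y -` (- {0}) \<inter> space M = space M - {s \<in> space M. Y s = 0}" by auto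
    also have "prob \<dots> = 1 - prob {s \<in> space M. Y s = 0}"
      by (rule prob_compl) (use Y in measurable)
    finally show ?thesis .
  qed
  have "{s \<in> space M. \<forall>j<L. X (int j) s \<noteq> 0} = (\<Inter>j\<in>int ` {..<L}. X j -` (- {0}) \<inter> space M)"
    using L by auto
  also have "prob \<dots> = (\<Prod>j\<in>int ` {..<L}. prob (X j -` (- {0}) \<inter> space M))"
    by (rule indep_varsD[OF indep]) (use L in auto)
  also have "\<dots> = (1 - prob {s \<in> space M. Y s = 0}) ^ L"
    by (simp add: single card_image)
  finally show ?thesis .
qed

theorem theorem2:
  fixes M :: "'a measure" and \<omega> :: "int \<Rightarrow> 'a \<Rightarrow> real" and \<omega>0 :: "'a \<Rightarrow> real"
    and L :: nat and p :: real
  assumes "prob_space M"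
    and "prob_space.indep_vars M (\<lambda>_. borel) \<omega> UNIV"
    and "\<omega>0 \<in> borel_measurable M"
    and "\<And>j. distr M borel (\<omega> j) = distr M borel \<omega>0"
    and "\<And>j s. s \<in> space M \<Longrightarrow> \<omega> j s \<ge> 0"
    and "p = measure M {s \<in> space M. \<omega>0 s = 0}"
    and "L > 0"
  defines "A \<equiv> {s \<in> space M. ((\<lambda>k. landscape_ratio (real L) k (\<lambda>j. \<omega> j s)) \<longlongrightarrow> pi\<^sup>2 / 8) at_top}"
    and "B \<equiv> {s \<in> space M. ((\<lambda>k. landscape_ratio (real L) k (\<lambda>j. \<omega> j s)) \<longlongrightarrow> 1) at_top}"
  shows "A \<in> sets M \<and> measure M A = 1 - (1 - p) ^ L \<and>
         B \<in> sets M \<and> measure M B = (1 - p) ^ L \<and>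
         (p = 0 \<longrightarrow> (AE s in M. ((\<lambda>k. landscape_ratio (real L) k (\<lambda>j. \<omega> j s)) \<longlongrightarrow> 1) at_top))"
proof -
  interpret prob_space M by fact
  define r where "r s = (\<lambda>k. landscape_ratio (real L) k (\<lambda>j. \<omega> j s))" for s
  define N where "N = {s \<in> space M. \<forall>j<L. \<omega> (int j) s \<noteq> 0}"
  have [measurable]: "\<omega> j \<in> borel_measurable M" for j
    using assms(2) by (auto simp: indep_vars_def)
  have N: "N \<in> sets M" unfolding N_def by measurable
  have probN: "prob N = (1 - p) ^ L"
    unfolding N_def \<open>p = _\<close> by (rule prob_all_nonzero) (use assms in auto)
  have lim_N: "(r s \<longlongrightarrow> 1) at_top" if "s \<in> N" for s
    unfolding r_def
  proof (rule landscape_ratio_tendsto_positive[OF \<open>L > 0\<close>])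
    fix j assume "j < L"
    then have "\<omega> (int j) s \<noteq> 0" "s \<in> space M" using that by (auto simp: N_def)
    then show "\<omega> (int j) s > 0" using assms(5)[of s "int j"] by simp
  qed
  have lim_not_N: "(r s \<longlongrightarrow> pi\<^sup>2 / 8) at_top" if "s \<in> space M - N" for s
    unfolding r_def
    by (rule landscape_ratio_tendsto_zero_run) (use that assms(5) in \<open>auto simp: N_def\<close>)
  \<comment> \<open>The limits differ since \<open>\<pi>\<^sup>2 > 9\<close>; hence the two events are complementary.\<close>
  have "pi\<^sup>2 > 3\<^sup>2" using pi_gt3 by (intro power_strict_mono) auto
  then have ne: "pi\<^sup>2 / 8 \<noteq> 1" by simp
  have B: "B = N"
  proof
    show "B \<subseteq> N"
    proof
      fix s assume "s \<in> B"
      then have s: "s \<in> space M" "(r s \<longlongrightarrow> 1) at_top" by (auto simp: B_def r_def)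
      show "s \<in> N"
      proof (rule ccontr)
        assume "s \<notin> N"
        then have "(r s \<longlongrightarrow> pi\<^sup>2 / 8) at_top" using s(1) by (intro lim_not_N) simp
        from tendsto_unique[OF trivial_limit_at_top_linorder this s(2)] show False using ne by simp
      qed
    qed
    show "N \<subseteq> B" using lim_N by (auto simp: B_def r_def N_def)
  qed
  have A: "A = space M - N"
  proof
    show "A \<subseteq> space M - N"
    proof
      fix s assume "s \<in> A"
      then have s: "s \<in> space M" "(r s \<longlongrightarrow> pi\<^sup>2 / 8) at_top" by (auto simp: A_def r_def)
      show "s \<in> space M - N"
      proof (rule ccontr)
        assume "s \<notin> space M - N"
        then have "(r s \<longlongrightarrow> 1) at_top" using s(1) by (intro lim_N) simp
        from tendsto_unique[OF trivial_limit_at_top_linorder s(2) this] show False using ne by simp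
      qed
    qed
    show "space M - N \<subseteq> A" using lim_not_N by (auto simp: A_def r_def)
  qed
  have "AE s in M. (r s \<longlongrightarrow> 1) at_top" if "p = 0"
  proof -
    have "AE s in M. s \<in> N" by (rule AE_prob_1) (simp add: probN that)
    then show ?thesis by eventually_elim (rule lim_N)
  qed
  then show ?thesis
    using N probN prob_compl[OF N] unfolding A B r_def by auto
qed

end
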